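(* Let $d\ge 1$. For $j\ge 1$ let $R_j$ be expanding $d\times d$ integer matrices, let $B_j,L_j\subset\mathbb{Z}^d$ be finite sets with $0\in B_j\cap L_j$, the elements of $B_j$ lying in pairwise distinct cosets of $R_j(\mathbb{Z}^d)$ in $\mathbb{Z}^d$, and let $0<C_j\le D_j<\infty$ with $\prod_{j=1}^\infty C_j>0$ and $\prod_{j=1}^\infty D_j<\infty$. Let $\mu=\mu(\{R_j,B_j\})$ be the associated infinite convolution measure, and assume that it satisfies the no-overlap condition. Let $\Lambda_n=L_1+R_1^{\mathtt T}L_2+\cdots+(R_1^{\mathtt T}R_2^{\mathtt T}\cdots R_{n-1}^{\mathtt T})L_n$ and $\Lambda=\bigcup_{n\ge1}\Lambda_n$. (i) Suppose that $\{(R_j,B_j,L_j)\}_{j\ge1}$ forms a frame tower with respect to the bounds $C_j,D_j$ and that $$\delta(\Lambda)=\inf_{n\ge 1}\inf_{\lambda\in\Lambda_n}|\widehat{\mu_{>n}}(\lambda)|^2>0.$$ Then $\{e^{2\pi i\langle\lambda,x\rangle}:\lambda\in\Lambda\}$ forms a frame for $L^2(\mu)$ with bounds $\prod_{j=1}^\infty C_j$, $\prod_{j=1}^\infty D_j$. (ii) Suppose that $\{(R_j,B_j,L_j)\}_{j\ge1}$ forms a Riesz sequence tower with respect to the bounds $C_j,D_j$. Then $\{e^{2\pi i\langle\lambda,x\rangle}:\lambda\in\Lambda\}$ forms a Riesz sequence for $L^2(\mu)$ with bounds $\prod_{j=1}^\infty C_j$, $\prod_{j=1}^\infty D_j$.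
   Context: A square matrix is expanding if all its eigenvalues have modulus $>1$. $A^{\mathtt T}$ denotes the transpose. Frame with bounds $C\le D$ (both in $(0,\infty)$) for a Hilbert space $H$: a collection $\{f_k\}$ with $C\|x\|^2\le\sum_k|\langle x,f_k\rangle|^2\le D\|x\|^2$ for all $x\in H$. Riesz sequence with bounds $C\le D$: $C\sum|a_k|^2\le\|\sum a_kf_k\|^2\le D\sum|a_k|^2$ for all finitely supported scalar sequences $(a_k)$. Triples and towers. For an expanding integer matrix $R$ and finite $B,L\subset\mathbb{Z}^d$ with $0\in B\cap L$, put $\mathbf{e}_{R,\lambda}=\frac{1}{\sqrt{\#B}}\big(e^{2\pi i\langle R^{-1}b,\lambda\rangle}\big)_{b\in B}\in\mathbb{C}^{\#B}$. $(R,B,L)$ forms a frame triple with bounds $C\le D$ if $C\|\mathbf{x}\|^2\le\sum_{\lambda\in L}|\langle\mathbf{x},\mathbf{e}_{R,\lambda}\rangle|^2\le D\|\mathbf{x}\|^2$ for all $\mathbf{x}\in\mathbb{C}^{\#B}$; it forms a Riesz sequence triple with bounds $C\le D$ if $C\sum_{\lambda\in L}|a_\lambda|^2\le\|\sum_{\lambda\in L}a_\lambda\mathbf{e}_{R,\lambda}\|^2\le D\sum_{\lambda\in L}|a_\lambda|^2$ for all $(a_\lambda)\in\mathbb{C}^{\#L}$. $\{(R_j,B_j,L_j)\}_{j\ge1}$ forms a frame tower (resp. Riesz sequence tower) with respect to $C_j,D_j$, where $0<C_j\le D_j<\infty$, $\prod_j C_j>0$, $\prod_j D_j<\infty$, if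 each $(R_j,B_j,L_j)$ is a frame triple (resp. Riesz sequence triple) with bounds $C_j,D_j$. Measure. $\mathbf{R}_n=R_nR_{n-1}\cdots R_1$; for a finite set $A$, $\delta_A=\frac{1}{\#A}\sum_{a\in A}\delta_a$ ($\delta_a$ the Dirac mass at $a$). $\mu=\delta_{\mathbf{R}_1^{-1}B_1}*\delta_{\mathbf{R}_2^{-1}B_2}*\cdots$, the infinite convolution being assumed to converge weakly to a Borel probability measure. $\mu_{>n}=\delta_{\mathbf{R}_{n+1}^{-1}B_{n+1}}*\delta_{\mathbf{R}_{n+2}^{-1}B_{n+2}}*\cdots$. $\mathbf{B}_n=\mathbf{R}_n\{\sum_{k=1}^n\mathbf{R}_k^{-1}b_k:b_k\in B_k\}$ and $K_n=\{\sum_{k=n+1}^\infty\mathbf{R}_k^{-1}b_k:b_k\in B_k\}$ (these series being assumed to converge). No-overlap condition: $\mu\big((\mathbf{R}_n^{-1}\mathbf{b}+K_n)\cap(\mathbf{R}_n^{-1}\mathbf{b}'+K_n)\big)=0$ for all $\mathbf{b}\ne\mathbf{b}'$ in $\mathbf{B}_n$ and all $n\ge1$. Fourier transform: $\widehat{\nu}(y)=\int e^{-2\pi i\langle y,x\rangle}d\nu(x)$. Frequencies. $\Lambda_n$ is the sumset displayed in the claim, a subset of $\mathbb{Z}^d$, and $\Lambda$ is the union of these sets.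
   Formalization: In (i) the frame claim is proved for the frequencies of Λ counted once per digit representation l_1+R_1^T l_2+..., and for the set Λ itself only if these representations are unique; for the plain set the lower bound can fail when different digit choices give the same λ. *)

theory Defs
  imports "HOL-Probability.Probability"
begin

section \<open>Integer matrices and vectors\<close>

text \<open>Matrices and vectors have entries in \<open>int\<close>. Sequences indexed by \<open>j \<ge> 1\<close> are functions on
  \<open>nat\<close> whose value at \<open>0\<close> is never used.\<close>

definition real_mat :: "int^'n^'n \<Rightarrow> real^'n^'n" where
  "real_mat A = map_matrix real_of_int A"

definition real_vec :: "int^'n \<Rightarrow> real^'n" where
  "real_vec v = (\<chi> i. real_of_int (v $ i))"

text \<open>The eigenvalues are the complex ones.\<close>

definition expanding :: "int^'n^'n \<Rightarrow> bool" where
  "expanding A \<longleftrightarrow>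
     (\<forall>(z::complex) (v::complex^'n).
        v \<noteq> 0 \<and> map_matrix of_int A *v v = z *s v \<longrightarrow> 1 < cmod z)"

definition distinct_cosets :: "int^'n^'n \<Rightarrow> (int^'n) set \<Rightarrow> bool" where
  "distinct_cosets A B \<longleftrightarrow> (\<forall>b\<in>B. \<forall>b'\<in>B. b \<noteq> b' \<longrightarrow> b - b' \<notin> range (\<lambda>v. A *v v))"

section \<open>Triples and towers\<close>

text \<open>A vector of \<open>\<complex>\<^sup>#\<^sup>B\<close> is a function on \<open>int^'n\<close> of which only the values on \<open>B\<close> are used.\<close>

definition evec :: "int^'n^'n \<Rightarrow> (int^'n) set \<Rightarrow> int^'n \<Rightarrow> int^'n \<Rightarrow> complex" where
  "evec R B l b =
     cis (2 * pi * ((matrix_inv (real_mat R) *v real_vec b) \<bullet> real_vec l)) / sqrt (card B)"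

definition frame_triple ::
  "int^'n^'n \<Rightarrow> (int^'n) set \<Rightarrow> (int^'n) set \<Rightarrow> real \<Rightarrow> real \<Rightarrow> bool" where
  "frame_triple R B L C D \<longleftrightarrow>
     (\<forall>x :: int^'n \<Rightarrow> complex.
        C * (\<Sum>b\<in>B. (cmod (x b))\<^sup>2) \<le> (\<Sum>l\<in>L. (cmod (\<Sum>b\<in>B. x b * cnj (evec R B l b)))\<^sup>2) \<and>
        (\<Sum>l\<in>L. (cmod (\<Sum>b\<in>B. x b * cnj (evec R B l b)))\<^sup>2) \<le> D * (\<Sum>b\<in>B. (cmod (x b))\<^sup>2))"

definition riesz_triple ::
  "int^'n^'n \<Rightarrow> (int^'n) set \<Rightarrow> (int^'n) set \<Rightarrow> real \<Rightarrow> real \<Rightarrow> bool" where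
  "riesz_triple R B L C D \<longleftrightarrow>
     (\<forall>a :: int^'n \<Rightarrow> complex.
        C * (\<Sum>l\<in>L. (cmod (a l))\<^sup>2) \<le> (\<Sum>b\<in>B. (cmod (\<Sum>l\<in>L. a l * evec R B l b))\<^sup>2) \<and>
        (\<Sum>b\<in>B. (cmod (\<Sum>l\<in>L. a l * evec R B l b))\<^sup>2) \<le> D * (\<Sum>l\<in>L. (cmod (a l))\<^sup>2))"

text \<open>For positive factors, \<^const>\<open>convergent_prod\<close> says that the partial products converge to a
  positive real. For \<open>D\<close> the limit cannot be \<open>0\<close> because \<open>C j \<le> D j\<close>.\<close>

definition tower_bounds :: "(nat \<Rightarrow> real) \<Rightarrow> (nat \<Rightarrow> real) \<Rightarrow> bool" where
  "tower_bounds C D \<longleftrightarrow>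
     (\<forall>j\<ge>1. 0 < C j \<and> C j \<le> D j) \<and>
     convergent_prod (\<lambda>j. C (Suc j)) \<and> 0 < (\<Prod>j. C (Suc j)) \<and>
     convergent_prod (\<lambda>j. D (Suc j))"

definition frame_tower ::
  "(nat \<Rightarrow> int^'n^'n) \<Rightarrow> (nat \<Rightarrow> (int^'n) set) \<Rightarrow> (nat \<Rightarrow> (int^'n) set) \<Rightarrow>
   (nat \<Rightarrow> real) \<Rightarrow> (nat \<Rightarrow> real) \<Rightarrow> bool" where
  "frame_tower R B L C D \<longleftrightarrow>
     tower_bounds C D \<and> (\<forall>j\<ge>1. frame_triple (R j) (B j) (L j) (C j) (D j))"

definition riesz_tower ::
  "(nat \<Rightarrow> int^'n^'n) \<Rightarrow> (nat \<Rightarrow> (int^'n) set) \<Rightarrow> (nat \<Rightarrow> (int^'n) set) \<Rightarrow>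
   (nat \<Rightarrow> real) \<Rightarrow> (nat \<Rightarrow> real) \<Rightarrow> bool" where
  "riesz_tower R B L C D \<longleftrightarrow>
     tower_bounds C D \<and> (\<forall>j\<ge>1. riesz_triple (R j) (B j) (L j) (C j) (D j))"

section \<open>The infinite convolution measure\<close>

text \<open>\<open>R n ** \<dots> ** R 1\<close>\<close>

primrec prodR :: "(nat \<Rightarrow> int^'n^'n) \<Rightarrow> nat \<Rightarrow> int^'n^'n" where
  "prodR R 0 = mat 1"
| "prodR R (Suc n) = R (Suc n) ** prodR R n"

definition scaled :: "(nat \<Rightarrow> int^'n^'n) \<Rightarrow> nat \<Rightarrow> int^'n \<Rightarrow> real^'n" where
  "scaled R k b = matrix_inv (real_mat (prodR R k)) *v real_vec b"

text \<open>\<open>(1 / #A) \<Sum>a\<in>A. \<delta>\<^sub>a\<close> as a Borel measure, for finite nonempty \<open>A\<close>\<close>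

definition unif :: "(real^'n) set \<Rightarrow> (real^'n) measure" where
  "unif A = distr (measure_pmf (pmf_of_set A)) borel (\<lambda>x. x)"

text \<open>The convolution of the factors with indices \<open>n + 1, \<dots>, n + m\<close>\<close>

primrec fin_conv ::
  "(nat \<Rightarrow> int^'n^'n) \<Rightarrow> (nat \<Rightarrow> (int^'n) set) \<Rightarrow> nat \<Rightarrow> nat \<Rightarrow> (real^'n) measure" where
  "fin_conv R B n 0 = return borel 0"
| "fin_conv R B n (Suc m) =
     (fin_conv R B n m \<star> unif (scaled R (n + Suc m) ` B (n + Suc m)))"

text \<open>Weak convergence in the library is only available on the real line.\<close>

definition weak_limit :: "(nat \<Rightarrow> (real^'n) measure) \<Rightarrow> (real^'n) measure \<Rightarrow> bool" where
  "weak_limit M N \<longleftrightarrow>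
     (\<forall>f :: real^'n \<Rightarrow> real. continuous_on UNIV f \<and> bounded (range f) \<longrightarrow>
        (\<lambda>m. \<integral>x. f x \<partial>M m) \<longlonglongrightarrow> (\<integral>x. f x \<partial>N))"

definition is_inf_conv ::
  "(nat \<Rightarrow> int^'n^'n) \<Rightarrow> (nat \<Rightarrow> (int^'n) set) \<Rightarrow> nat \<Rightarrow> (real^'n) measure \<Rightarrow> bool" where
  "is_inf_conv R B n M \<longleftrightarrow>
     prob_space M \<and> sets M = sets borel \<and> weak_limit (fin_conv R B n) M"

text \<open>The measure \<open>\<mu>\<^sub>>\<^sub>n\<close>. Weak limits are unique, so the description determines it whenever the
  convolution converges.\<close>

definition mu_gt ::
  "(nat \<Rightarrow> int^'n^'n) \<Rightarrow> (nat \<Rightarrow> (int^'n) set) \<Rightarrow> nat \<Rightarrow> (real^'n) measure" where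
  "mu_gt R B n = (THE M. is_inf_conv R B n M)"

definition bold_B ::
  "(nat \<Rightarrow> int^'n^'n) \<Rightarrow> (nat \<Rightarrow> (int^'n) set) \<Rightarrow> nat \<Rightarrow> (real^'n) set" where
  "bold_B R B n =
     {real_mat (prodR R n) *v (\<Sum>k=1..n. scaled R k (b k)) | b. \<forall>k\<in>{1..n}. b k \<in> B k}"

definition series_converge ::
  "(nat \<Rightarrow> int^'n^'n) \<Rightarrow> (nat \<Rightarrow> (int^'n) set) \<Rightarrow> bool" where
  "series_converge R B \<longleftrightarrow>
     (\<forall>b. (\<forall>k\<ge>1. b k \<in> B k) \<longrightarrow> summable (\<lambda>k. scaled R (Suc k) (b (Suc k))))"

definition K_set ::
  "(nat \<Rightarrow> int^'n^'n) \<Rightarrow> (nat \<Rightarrow> (int^'n) set) \<Rightarrow> nat \<Rightarrow> (real^'n) set" where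
  "K_set R B n = {(\<Sum>k. scaled R (n + Suc k) (b (n + Suc k))) | b. \<forall>k>n. b k \<in> B k}"

text \<open>If the series converge then \<^const>\<open>K_set\<close> is compact, so the measured sets are Borel.\<close>

definition no_overlap ::
  "(nat \<Rightarrow> int^'n^'n) \<Rightarrow> (nat \<Rightarrow> (int^'n) set) \<Rightarrow> (real^'n) measure \<Rightarrow> bool" where
  "no_overlap R B \<mu> \<longleftrightarrow>
     (\<forall>n\<ge>1. \<forall>p\<in>bold_B R B n. \<forall>q\<in>bold_B R B n. p \<noteq> q \<longrightarrow>
        emeasure \<mu>
          ((\<lambda>x. matrix_inv (real_mat (prodR R n)) *v p + x) ` K_set R B n \<inter>
           (\<lambda>x. matrix_inv (real_mat (prodR R n)) *v q + x) ` K_set R B n) = 0)"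

definition fourier :: "(real^'n) measure \<Rightarrow> real^'n \<Rightarrow> complex" where
  "fourier \<nu> y = (\<integral>x. cis (- 2 * pi * (y \<bullet> x)) \<partial>\<nu>)"

section \<open>Frequencies\<close>

text \<open>\<open>(R 1)\<^sup>T ** \<dots> ** (R n)\<^sup>T\<close>\<close>

primrec prodRT :: "(nat \<Rightarrow> int^'n^'n) \<Rightarrow> nat \<Rightarrow> int^'n^'n" where
  "prodRT R 0 = mat 1"
| "prodRT R (Suc n) = prodRT R n ** transpose (R (Suc n))"

definition Lambda_n ::
  "(nat \<Rightarrow> int^'n^'n) \<Rightarrow> (nat \<Rightarrow> (int^'n) set) \<Rightarrow> nat \<Rightarrow> (int^'n) set" where
  "Lambda_n R L n = {(\<Sum>k=1..n. prodRT R (k - 1) *v l k) | l. \<forall>k\<in>{1..n}. l k \<in> L k}"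

definition Lambda ::
  "(nat \<Rightarrow> int^'n^'n) \<Rightarrow> (nat \<Rightarrow> (int^'n) set) \<Rightarrow> (int^'n) set" where
  "Lambda R L = (\<Union>n\<in>{1..}. Lambda_n R L n)"

definition delta_Lambda ::
  "(nat \<Rightarrow> int^'n^'n) \<Rightarrow> (nat \<Rightarrow> (int^'n) set) \<Rightarrow> (nat \<Rightarrow> (int^'n) set) \<Rightarrow> real" where
  "delta_Lambda R B L =
     (INF n\<in>{1..}. INF l\<in>Lambda_n R L n. (cmod (fourier (mu_gt R B n) (real_vec l)))\<^sup>2)"

text \<open>Digit expansions \<open>l\<close> of the frequencies. Since \<open>0 \<in> L k\<close>, an expansion of length \<open>n\<close> is
  identified with its continuation by zeros. A frequency may have several expansions:
  the digits in \<open>L k\<close> of a frame triple need not be distinct modulo \<open>(R k)\<^sup>T\<close>. The product of the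
  lower frame bounds then refers to the exponentials counted with multiplicity; with
  \<open>R k = 4\<close>, \<open>B k = {0, 2}\<close>, \<open>L 1 = {0, 1, 8, 9}\<close>, \<open>L 2 = {0, -1, -2, 1}\<close> and \<open>L k = {0, 1}\<close> for
  \<open>k > 2\<close> that product is \<open>4\<close>, while \<open>3\<close> is an upper frame bound for the set of exponentials.\<close>

definition digit_seqs :: "(nat \<Rightarrow> (int^'n) set) \<Rightarrow> (nat \<Rightarrow> int^'n) set" where
  "digit_seqs L = {l. l 0 = 0 \<and> (\<forall>k\<ge>1. l k \<in> L k) \<and> finite {k. l k \<noteq> 0}}"

definition freq :: "(nat \<Rightarrow> int^'n^'n) \<Rightarrow> (nat \<Rightarrow> int^'n) \<Rightarrow> int^'n" where
  "freq R l = (\<Sum>k | l k \<noteq> 0. prodRT R (k - 1) *v l k)"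

lemma freq_eq:
  assumes "l 0 = 0" "\<And>k. k > n \<Longrightarrow> l k = 0"
  shows "freq R l = (\<Sum>k=1..n. prodRT R (k - 1) *v l k)"
proof -
  have "{k. l k \<noteq> 0} \<subseteq> {1..n}"
    using assms by (auto simp: Suc_le_eq) (metis not_gr_zero, meson not_le)
  then show ?thesis
    unfolding freq_def by (intro sum.mono_neutral_left) auto
qed

lemma freq_digit_seqs:
  assumes "\<And>k. k \<ge> 1 \<Longrightarrow> 0 \<in> L k"
  shows "freq R ` digit_seqs L = Lambda R L"
proof (intro equalityI subsetI)
  fix x assume "x \<in> freq R ` digit_seqs L"
  then obtain l where x: "x = freq R l" and l: "l 0 = 0" "\<And>k. k \<ge> 1 \<Longrightarrow> l k \<in> L k"
    and fin: "finite {k. l k \<noteq> 0}"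
    by (auto simp: digit_seqs_def)
  from fin obtain m where "\<forall>k\<in>{k. l k \<noteq> 0}. k \<le> m"
    using finite_nat_set_iff_bounded_le by blast
  then have m: "l k = 0" if "k > Suc m" for k
    using that by force
  have "x = (\<Sum>k=1..Suc m. prodRT R (k - 1) *v l k)"
    unfolding x by (rule freq_eq) (use l m in auto)
  then have "x \<in> Lambda_n R L (Suc m)"
    unfolding Lambda_n_def using l by auto
  then show "x \<in> Lambda R L"
    unfolding Lambda_def by force
next
  fix x assume "x \<in> Lambda R L"
  then obtain n l where x: "x = (\<Sum>k=1..n. prodRT R (k - 1) *v l k)"
    and l: "\<And>k. k \<in> {1..n} \<Longrightarrow> l k \<in> L k"
    by (auto simp: Lambda_def Lambda_n_def)
  define l' where "l' k = (if k \<in> {1..n} then l k else 0)" for k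
  have "finite {k. l' k \<noteq> 0}"
    by (rule finite_subset[of _ "{1..n}"]) (auto simp: l'_def)
  then have "l' \<in> digit_seqs L"
    using l assms by (auto simp: digit_seqs_def l'_def)
  moreover have "freq R l' = (\<Sum>k=1..n. prodRT R (k - 1) *v l' k)"
    by (rule freq_eq) (auto simp: l'_def)
  then have "freq R l' = x"
    unfolding x by (simp add: l'_def)
  ultimately show "x \<in> freq R ` digit_seqs L"
    by blast
qed

section \<open>Frames and Riesz sequences in \<open>L\<^sup>2(\<mu>)\<close>\<close>

text \<open>Elements of \<open>L\<^sup>2(\<mu>)\<close> are represented by functions, and the collections are indexed families.\<close>

definition in_L2 :: "'a measure \<Rightarrow> ('a \<Rightarrow> complex) \<Rightarrow> bool" where
  "in_L2 \<mu> f \<longleftrightarrow> f \<in> borel_measurable \<mu> \<and> integrable \<mu> (\<lambda>x. (cmod (f x))\<^sup>2)"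

definition L2_frame ::
  "'a measure \<Rightarrow> 'i set \<Rightarrow> ('i \<Rightarrow> 'a \<Rightarrow> complex) \<Rightarrow> real \<Rightarrow> real \<Rightarrow> bool" where
  "L2_frame \<mu> I e C D \<longleftrightarrow>
     0 < C \<and> C \<le> D \<and> (\<forall>i\<in>I. in_L2 \<mu> (e i)) \<and>
     (\<forall>f. in_L2 \<mu> f \<longrightarrow>
        (\<lambda>i. (cmod (\<integral>x. f x * cnj (e i x) \<partial>\<mu>))\<^sup>2) summable_on I \<and>
        C * (\<integral>x. (cmod (f x))\<^sup>2 \<partial>\<mu>) \<le> (\<Sum>\<^sub>\<infinity>i\<in>I. (cmod (\<integral>x. f x * cnj (e i x) \<partial>\<mu>))\<^sup>2) \<and>
        (\<Sum>\<^sub>\<infinity>i\<in>I. (cmod (\<integral>x. f x * cnj (e i x) \<partial>\<mu>))\<^sup>2) \<le> D * (\<integral>x. (cmod (f x))\<^sup>2 \<partial>\<mu>))"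

definition L2_riesz_sequence ::
  "'a measure \<Rightarrow> 'i set \<Rightarrow> ('i \<Rightarrow> 'a \<Rightarrow> complex) \<Rightarrow> real \<Rightarrow> real \<Rightarrow> bool" where
  "L2_riesz_sequence \<mu> I e C D \<longleftrightarrow>
     0 < C \<and> C \<le> D \<and> (\<forall>i\<in>I. in_L2 \<mu> (e i)) \<and>
     (\<forall>F (a :: 'i \<Rightarrow> complex). finite F \<and> F \<subseteq> I \<longrightarrow>
        C * (\<Sum>i\<in>F. (cmod (a i))\<^sup>2) \<le> (\<integral>x. (cmod (\<Sum>i\<in>F. a i * e i x))\<^sup>2 \<partial>\<mu>) \<and>
        (\<integral>x. (cmod (\<Sum>i\<in>F. a i * e i x))\<^sup>2 \<partial>\<mu>) \<le> D * (\<Sum>i\<in>F. (cmod (a i))\<^sup>2))"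

definition expo :: "int^'n \<Rightarrow> real^'n \<Rightarrow> complex" where
  "expo l x = cis (2 * pi * (real_vec l \<bullet> x))"

end

theory Submission
  imports Defs
begin

text \<open>Let the digits be independent and uniformly distributed, and let \<open>X\<close> be the sum of the digit
  series, so that \<open>\<mu>\<close> is the law of \<open>X\<close>. The bounds of the triples multiply along the tower to frame
  (Riesz) bounds for the exponentials at the partial sum of the first \<open>n\<close> digits, because the mixed
  terms of the exponents are integers or unimodular factors. The Riesz bounds pass to the limit by
  dominated convergence.

  For the frame bounds let \<open>H\<close> be a function of finitely many digits. For large \<open>n\<close> its
  coefficient at \<open>\<lambda>\<close> is the coefficient at level \<open>n\<close> times \<open>\<mu>\<^sub>>\<^sub>n\<close>-hat of \<open>\<lambda>\<close>. The last factor has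
  modulus at most \<open>1\<close>, which gives the upper bound. It tends to \<open>1\<close> and stays away from \<open>0\<close> by
  \<open>\<delta>(\<Lambda>) > 0\<close>, so the level \<open>n\<close> coefficients are dominated by a constant multiple of the limit
  coefficients; dominated convergence for sums then gives the lower bound without loss of the factor
  \<open>\<delta>(\<Lambda>)\<close>. Every \<open>f(X)\<close> with \<open>f\<close> in \<open>L\<^sup>2(\<mu>)\<close> is an \<open>L\<^sup>2\<close>-limit of such \<open>H\<close>, since continuous
  functions are dense and the partial sums converge to \<open>X\<close>.\<close>

section \<open>Integer matrices and digit expansions\<close>

text \<open>The argument lives on the space of digit sequences: there a function of finitely many
  digits is available at once, independence turns its integrals into finite averages, and only at
  the very end are the inequalities applied to compositions \<open>f (X \<omega>)\<close>. Two
  limits have to be taken without spoiling the constants. When the level tends to infinity with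
  \<open>H\<close> fixed, termwise convergence of the squared coefficients gives only the Fatou
  direction, the wrong one for a lower bound: part of the sum could escape to ever longer
  expansions. A summable majorant excludes this, and \<open>\<delta>(\<Lambda>) > 0\<close> supplies
  it. When \<open>H\<close> tends to \<open>f (X \<omega>)\<close>, a triangle inequality with
  factor 2 would ruin the bounds; the weighted form with factors \<open>1 + t\<close> and
  \<open>1 + 1 / t\<close> is used instead, and \<open>t\<close> is sent to 0 after the
  approximation error. The finite level estimates sum over expansions and not over their values,
  which is why the frame is first obtained as a family indexed by
  \<open>digit_seqs L\<close>.\<close>

lemma matrix_inv_left_right:
  fixes A :: "'a::semiring_1^'n^'n"
  assumes "invertible A"
  shows "A ** matrix_inv A = mat 1" "matrix_inv A ** A = mat 1"
  using assms someI_ex[of "\<lambda>A'. A ** A' = mat 1 \<and> A' ** A = mat 1"]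
  by (auto simp: invertible_def matrix_inv_def)

lemma matrix_inv_mult:
  fixes A B :: "'a::semiring_1^'n^'n"
  assumes "invertible A" "invertible B"
  shows "matrix_inv (A ** B) = matrix_inv B ** matrix_inv A"
proof -
  note A = matrix_inv_left_right[OF assms(1)] and B = matrix_inv_left_right[OF assms(2)]
  note AB = matrix_inv_left_right[OF invertible_mult[OF assms]]
  have "(matrix_inv B ** matrix_inv A) ** (A ** B) = mat 1"
    by (metis A(2) B(2) matrix_mul_assoc matrix_mul_lid)
  then show ?thesis
    by (metis AB(1) matrix_mul_assoc matrix_mul_lid matrix_mul_rid)
qed

lemma inner_matrix_vector_mult:
  fixes A :: "real^'n^'m"
  shows "(A *v x) \<bullet> y = x \<bullet> (transpose A *v y)"
  by (metis dot_lmul_matrix transpose_matrix_vector inner_commute)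

lemma real_vec_simps [simp]:
  "real_vec 0 = 0" "real_vec (a + b) = real_vec a + real_vec b"
  "real_vec (A *v v) = real_mat A *v real_vec v"
  by (simp_all add: real_vec_def real_mat_def vec_eq_iff matrix_vector_mult_def)

lemma real_vec_inj [simp]: "real_vec a = real_vec b \<longleftrightarrow> a = b"
  by (simp add: real_vec_def vec_eq_iff)

lemma real_vec_inner_Ints: "real_vec a \<bullet> real_vec b \<in> \<int>"
  by (auto simp: real_vec_def inner_vec_def intro!: Ints_sum)

lemma real_mat_simps [simp]:
  "real_mat (mat 1) = mat 1" "real_mat (A ** B) = real_mat A ** real_mat B"
  "real_mat (transpose A) = transpose (real_mat A)"
  by (simp_all add: real_mat_def vec_eq_iff matrix_matrix_mult_def mat_def transpose_def)

text \<open>A nonzero real kernel vector, read as a complex vector, would be an eigenvector for the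
  eigenvalue 0, whose modulus is not above 1.\<close>

lemma expanding_imp_invertible:
  assumes "expanding A"
  shows "invertible (real_mat A)"
proof -
  have "x = 0" if x: "real_mat A *v x = 0" for x
  proof (rule ccontr)
    assume "x \<noteq> 0"
    define v :: "complex^'a" where "v = (\<chi> i. of_real (x $ i))"
    have "v \<noteq> 0"
      using \<open>x \<noteq> 0\<close> by (simp add: v_def vec_eq_iff)
    moreover have "map_matrix of_int A *v v = 0 *s v"
    proof (simp add: vec_eq_iff matrix_vector_mult_def v_def, intro allI)
      fix i
      have "(\<Sum>j\<in>UNIV. real_of_int (A $ i $ j) * x $ j) = 0"
        using x by (simp add: vec_eq_iff matrix_vector_mult_def real_mat_def)
      then have "complex_of_real (\<Sum>j\<in>UNIV. real_of_int (A $ i $ j) * x $ j) = 0"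
        by simp
      then show "(\<Sum>j\<in>UNIV. complex_of_int (A $ i $ j) * complex_of_real (x $ j)) = 0"
        by simp
    qed
    ultimately have "1 < cmod 0"
      using assms unfolding expanding_def by blast
    then show False by simp
  qed
  then show ?thesis
    using invertible_left_inverse matrix_left_invertible_ker by blast
qed

lemma invertible_prodR:
  assumes "\<And>j. j \<ge> 1 \<Longrightarrow> invertible (real_mat (R j))"
  shows "invertible (real_mat (prodR R n))"
proof (induction n)
  case 0
  have "invertible (mat 1 :: real^'a^'a)"
    unfolding invertible_def by (rule exI[of _ "mat 1"]) simp
  then show ?case by simp
qed (simp add: assms invertible_mult)

lemma prodRT_eq: "prodRT R n = transpose (prodR R n)"
  by (induction n) (simp_all add: matrix_transpose_mul)

text \<open>Since \<open>k \<le> n\<close>, the inverse of \<open>prodR R k\<close> cancels against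
  \<open>prodR R n\<close> and leaves the integer matrix \<open>R n ** ... ** R (Suc k)\<close>
  acting on \<open>b\<close>. The induction therefore starts at \<open>n = k\<close>.\<close>

lemma prodR_scaled:
  assumes inv: "\<And>j. j \<ge> 1 \<Longrightarrow> invertible (real_mat (R j))" and "k \<le> n"
  shows "\<exists>v. real_mat (prodR R n) *v scaled R k b = real_vec v"
  using \<open>k \<le> n\<close>
proof (induction n rule: dec_induct)
  case base
  have "real_mat (prodR R k) *v scaled R k b = real_vec b"
    using matrix_inv_left_right(1)[OF invertible_prodR[OF inv]]
    by (simp add: scaled_def matrix_vector_mul_assoc)
  then show ?case by blast
next
  case (step n)
  then obtain v where "real_mat (prodR R n) *v scaled R k b = real_vec v" by blast
  then have "real_mat (prodR R (Suc n)) *v scaled R k b = real_vec (R (Suc n) *v v)"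
    by (simp flip: matrix_vector_mul_assoc)
  then show ?case by blast
qed

text \<open>Transposition moves \<open>prodRT R n\<close> to the other side of the inner product,
  where \<open>prodR_scaled\<close> makes the vector integral. Digits of the measure up to level
  \<open>n\<close> are thus blind to frequency digits beyond level \<open>n\<close>.\<close>

lemma scaled_inner_prodRT_Ints:
  assumes "\<And>j. j \<ge> 1 \<Longrightarrow> invertible (real_mat (R j))" and "k \<le> n"
  shows "scaled R k b \<bullet> real_vec (prodRT R n *v t) \<in> \<int>"
proof -
  obtain v where "real_mat (prodR R n) *v scaled R k b = real_vec v"
    using prodR_scaled[of R, OF assms] by blast
  then have "scaled R k b \<bullet> real_vec (prodRT R n *v t) = real_vec v \<bullet> real_vec t"
    by (metis inner_matrix_vector_mult prodRT_eq real_mat_simps(3) real_vec_simps(3))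
  then show ?thesis
    using real_vec_inner_Ints by metis
qed

text \<open>The scaling now has one factor more than the transposed product, so exactly the inverse
  of \<open>R (Suc n)\<close> survives. What remains is the exponent of \<open>evec\<close> for the
  triple of level \<open>Suc n\<close>; this is how the triples enter.\<close>

lemma scaled_inner_prodRT_Suc:
  assumes "\<And>j. j \<ge> 1 \<Longrightarrow> invertible (real_mat (R j))"
  shows "scaled R (Suc n) b \<bullet> real_vec (prodRT R n *v t) =
    (matrix_inv (real_mat (R (Suc n))) *v real_vec b) \<bullet> real_vec t"
proof -
  let ?P = "real_mat (prodR R n)"
  have P: "invertible ?P" by (rule invertible_prodR[OF assms])
  have "?P *v scaled R (Suc n) b =
      (?P ** (matrix_inv ?P ** matrix_inv (real_mat (R (Suc n))))) *v real_vec b"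
    by (simp add: scaled_def matrix_inv_mult P assms matrix_vector_mul_assoc)
  also have "\<dots> = matrix_inv (real_mat (R (Suc n))) *v real_vec b"
    by (simp add: matrix_mul_assoc matrix_inv_left_right[OF P])
  finally show ?thesis
    by (metis inner_matrix_vector_mult prodRT_eq real_mat_simps(3) real_vec_simps(3))
qed

text \<open>\<open>unif\<close> is formed over an image set, so injectivity is what keeps its
  weights equal to \<open>1 / card (B k)\<close>.\<close>

lemma inj_scaled:
  assumes "\<And>j. j \<ge> 1 \<Longrightarrow> invertible (real_mat (R j))"
  shows "inj_on (scaled R k) A"
proof (rule inj_onI)
  fix x y assume "scaled R k x = scaled R k y"
  then have "real_mat (prodR R k) *v scaled R k x = real_mat (prodR R k) *v scaled R k y"
    by simp
  then have "real_vec x = real_vec y"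
    using matrix_inv_left_right(1)[OF invertible_prodR[OF assms]]
    by (simp add: scaled_def matrix_vector_mul_assoc)
  then show "x = y" by simp
qed

text \<open>Blocks of digits are total functions padded by 0, not functions on \<open>J\<close>.
  Expansions of different lengths then have one type, and finite expansions are themselves elements
  of \<open>digit_seqs\<close>.\<close>

definition digs :: "(nat \<Rightarrow> 'a::zero set) \<Rightarrow> nat set \<Rightarrow> (nat \<Rightarrow> 'a) set" where
  "digs A J = {l. (\<forall>k\<in>J. l k \<in> A k) \<and> (\<forall>k. k \<notin> J \<longrightarrow> l k = 0)}"

text \<open>To depend only on the digits in \<open>J\<close> will mean to factor through
  \<open>trunc J\<close>.\<close>

definition trunc :: "nat set \<Rightarrow> (nat \<Rightarrow> 'a::zero) \<Rightarrow> nat \<Rightarrow> 'a" where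
  "trunc J l = (\<lambda>k. if k \<in> J then l k else 0)"

lemma digs_insert:
  assumes "j \<notin> J"
  shows "digs A (insert j J) = (\<lambda>(l, t). l(j := t)) ` (digs A J \<times> A j)"
proof (intro equalityI subsetI)
  fix l assume "l \<in> digs A (insert j J)"
  then have "l = (\<lambda>(l, t). l(j := t)) (l(j := 0), l j)" "(l(j := 0), l j) \<in> digs A J \<times> A j"
    using assms by (auto simp: digs_def)
  then show "l \<in> (\<lambda>(l, t). l(j := t)) ` (digs A J \<times> A j)" by blast
qed (use assms in \<open>auto simp: digs_def\<close>)

lemma inj_on_digs_upd:
  assumes "j \<notin> J"
  shows "inj_on (\<lambda>(l, t). l(j := t)) (digs A J \<times> S)"
proof (rule inj_onI, clarsimp)
  fix l t l' t'
  assume l: "l \<in> digs A J" "l' \<in> digs A J" and eq: "l(j := t) = l'(j := t')"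
  have "l k = l' k" for k
    using l assms fun_cong[OF eq, of k] by (cases "k = j") (auto simp: digs_def)
  then show "l = l' \<and> t = t'"
    using fun_cong[OF eq, of j] by auto
qed

lemma sum_digs_insert:
  assumes "j \<notin> J"
  shows "(\<Sum>l\<in>digs A (insert j J). f l) = (\<Sum>l\<in>digs A J. \<Sum>t\<in>A j. f (l(j := t)))"
  unfolding digs_insert[OF assms] sum.reindex[OF inj_on_digs_upd[OF assms]]
  by (simp add: sum.cartesian_product case_prod_beta comp_def)

lemma digs_empty [simp]: "digs A {} = {\<lambda>_. 0}"
  by (auto simp: digs_def)

lemma finite_digs [intro]:
  assumes "finite J" "\<And>k. k \<in> J \<Longrightarrow> finite (A k)"
  shows "finite (digs A J)"
  using assms by (induction J) (auto simp: digs_insert)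

lemma card_digs:
  assumes "finite J"
  shows "card (digs A J) = (\<Prod>k\<in>J. card (A k))"
  using assms
  by (induction J) (auto simp: digs_insert card_image[OF inj_on_digs_upd] card_cartesian_product)

text \<open>The finite form of the independence of two disjoint blocks. The induction peels digits
  off \<open>J\<close>; the peeled digit is summed into \<open>g\<close>, hence \<open>g\<close> is
  arbitrary in the induction.\<close>

lemma sum_digs_split:
  fixes f g :: "_ \<Rightarrow> 'b::comm_semiring_1"
  assumes "finite J" "J \<inter> K = {}"
  shows "(\<Sum>l\<in>digs A (J \<union> K). f (trunc K l) * g (trunc J l)) =
         (\<Sum>l\<in>digs A K. f l) * (\<Sum>l\<in>digs A J. g l)"
  using assms
proof (induction J arbitrary: g)
  case empty
  have "f (trunc K l) * g (trunc {} l) = f l * g (\<lambda>_. 0)" if "l \<in> digs A K" for l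
  proof -
    have "trunc K l = l" "trunc {} l = (\<lambda>_. 0)"
      using that by (auto simp: digs_def trunc_def)
    then show ?thesis by simp
  qed
  then show ?case by (simp add: sum_distrib_right)
next
  case (insert j J)
  have tr: "trunc K (l(j := t)) = trunc K l" "trunc (insert j J) (l(j := t)) = (trunc J l)(j := t)" for l t
    using insert.prems insert.hyps by (auto simp: trunc_def)
  have "(\<Sum>l\<in>digs A (insert j J \<union> K). f (trunc K l) * g (trunc (insert j J) l)) =
      (\<Sum>l\<in>digs A (J \<union> K). f (trunc K l) * (\<Sum>t\<in>A j. g ((trunc J l)(j := t))))"
    using insert.prems insert.hyps by (simp add: sum_digs_insert tr sum_distrib_left)
  also have "\<dots> = (\<Sum>l\<in>digs A K. f l) * (\<Sum>l\<in>digs A J. \<Sum>t\<in>A j. g (l(j := t)))"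
    using insert.prems by (intro insert.IH) auto
  also have "(\<Sum>l\<in>digs A J. \<Sum>t\<in>A j. g (l(j := t))) = (\<Sum>l\<in>digs A (insert j J). g l)"
    using insert.hyps by (simp add: sum_digs_insert)
  finally show ?case .
qed

section \<open>Frame and Riesz bounds at a finite level\<close>

definition cis2pi :: "real \<Rightarrow> complex" where
  "cis2pi t = cis (2 * pi * t)"

lemma cis2pi_add: "cis2pi (s + t) = cis2pi s * cis2pi t"
  by (simp add: cis2pi_def cis_mult ring_distribs)

lemma cnj_cis2pi: "cnj (cis2pi t) = cis2pi (- t)"
  by (simp add: cis2pi_def cis_cnj)

lemma cmod_cis2pi [simp]: "cmod (cis2pi t) = 1"
  by (simp add: cis2pi_def)

lemma cis2pi_0 [simp]: "cis2pi 0 = 1"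
  by (simp add: cis2pi_def)

lemma cis2pi_Ints: "t \<in> \<int> \<Longrightarrow> cis2pi t = 1"
  by (auto simp: cis2pi_def elim!: Ints_cases)

lemma continuous_on_cis2pi [continuous_intros]: "continuous_on S f \<Longrightarrow> continuous_on S (\<lambda>x. cis2pi (f x))"
  unfolding cis2pi_def by (intro continuous_intros)

definition psum :: "(nat \<Rightarrow> int^'n^'n) \<Rightarrow> nat set \<Rightarrow> (nat \<Rightarrow> int^'n) \<Rightarrow> real^'n" where
  "psum R J b = (\<Sum>k\<in>J. scaled R k (b k))"

definition phase :: "(nat \<Rightarrow> int^'n^'n) \<Rightarrow> nat \<Rightarrow> (nat \<Rightarrow> int^'n) \<Rightarrow> (nat \<Rightarrow> int^'n) \<Rightarrow> complex" where
  "phase R n b l = cis2pi (psum R {1..n} b \<bullet> real_vec (freq R l))"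

text \<open>This is \<open>evec\<close> without its factor \<open>1 / sqrt (card B)\<close>. Left
  unnormalised, the levels multiply to a single cardinality, which cancels when sums are turned into
  expectations.\<close>

definition digit_char :: "int^'n^'n \<Rightarrow> int^'n \<Rightarrow> int^'n \<Rightarrow> complex" where
  "digit_char A b l = cis2pi ((matrix_inv (real_mat A) *v real_vec b) \<bullet> real_vec l)"

lemma evec_eq: "evec A B l b = digit_char A b l / sqrt (card B)"
  by (simp add: evec_def digit_char_def cis2pi_def)

lemma frame_tripleD:
  assumes "frame_triple A B L C D" "finite B" "B \<noteq> {}"
  shows "C * card B * (\<Sum>b\<in>B. (cmod (x b))\<^sup>2) \<le> (\<Sum>l\<in>L. (cmod (\<Sum>b\<in>B. x b * cnj (digit_char A b l)))\<^sup>2)"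
    and "(\<Sum>l\<in>L. (cmod (\<Sum>b\<in>B. x b * cnj (digit_char A b l)))\<^sup>2) \<le> D * card B * (\<Sum>b\<in>B. (cmod (x b))\<^sup>2)"
proof -
  have pos: "real (card B) > 0"
    using assms by (simp add: card_gt_0_iff)
  have "(\<Sum>b\<in>B. x b * cnj (evec A B l b)) = (\<Sum>b\<in>B. x b * cnj (digit_char A b l)) / sqrt (card B)" for l
    by (simp add: evec_eq sum_divide_distrib)
  then have "(\<Sum>l\<in>L. (cmod (\<Sum>b\<in>B. x b * cnj (evec A B l b)))\<^sup>2) =
      (\<Sum>l\<in>L. (cmod (\<Sum>b\<in>B. x b * cnj (digit_char A b l)))\<^sup>2) / card B"
    using pos by (simp add: norm_divide power_divide flip: sum_divide_distrib)
  then have "C * (\<Sum>b\<in>B. (cmod (x b))\<^sup>2) \<le> (\<Sum>l\<in>L. (cmod (\<Sum>b\<in>B. x b * cnj (digit_char A b l)))\<^sup>2) / card B"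
    and "(\<Sum>l\<in>L. (cmod (\<Sum>b\<in>B. x b * cnj (digit_char A b l)))\<^sup>2) / card B \<le> D * (\<Sum>b\<in>B. (cmod (x b))\<^sup>2)"
    using assms(1)[unfolded frame_triple_def, rule_format, of x] by auto
  then show "C * card B * (\<Sum>b\<in>B. (cmod (x b))\<^sup>2) \<le> (\<Sum>l\<in>L. (cmod (\<Sum>b\<in>B. x b * cnj (digit_char A b l)))\<^sup>2)"
    and "(\<Sum>l\<in>L. (cmod (\<Sum>b\<in>B. x b * cnj (digit_char A b l)))\<^sup>2) \<le> D * card B * (\<Sum>b\<in>B. (cmod (x b))\<^sup>2)"
    using pos by (simp_all add: field_simps)
qed

lemma riesz_tripleD:
  assumes "riesz_triple A B L C D" "finite B" "B \<noteq> {}"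
  shows "C * card B * (\<Sum>l\<in>L. (cmod (a l))\<^sup>2) \<le> (\<Sum>b\<in>B. (cmod (\<Sum>l\<in>L. a l * digit_char A b l))\<^sup>2)"
    and "(\<Sum>b\<in>B. (cmod (\<Sum>l\<in>L. a l * digit_char A b l))\<^sup>2) \<le> D * card B * (\<Sum>l\<in>L. (cmod (a l))\<^sup>2)"
proof -
  have pos: "real (card B) > 0"
    using assms by (simp add: card_gt_0_iff)
  have "(\<Sum>l\<in>L. a l * evec A B l b) = (\<Sum>l\<in>L. a l * digit_char A b l) / sqrt (card B)" for b
    by (simp add: evec_eq sum_divide_distrib)
  then have "(\<Sum>b\<in>B. (cmod (\<Sum>l\<in>L. a l * evec A B l b))\<^sup>2) =
      (\<Sum>b\<in>B. (cmod (\<Sum>l\<in>L. a l * digit_char A b l))\<^sup>2) / card B"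
    using pos by (simp add: norm_divide power_divide flip: sum_divide_distrib)
  then have "C * (\<Sum>l\<in>L. (cmod (a l))\<^sup>2) \<le> (\<Sum>b\<in>B. (cmod (\<Sum>l\<in>L. a l * digit_char A b l))\<^sup>2) / card B"
    and "(\<Sum>b\<in>B. (cmod (\<Sum>l\<in>L. a l * digit_char A b l))\<^sup>2) / card B \<le> D * (\<Sum>l\<in>L. (cmod (a l))\<^sup>2)"
    using assms(1)[unfolded riesz_triple_def, rule_format, of a] by auto
  then show "C * card B * (\<Sum>l\<in>L. (cmod (a l))\<^sup>2) \<le> (\<Sum>b\<in>B. (cmod (\<Sum>l\<in>L. a l * digit_char A b l))\<^sup>2)"
    and "(\<Sum>b\<in>B. (cmod (\<Sum>l\<in>L. a l * digit_char A b l))\<^sup>2) \<le> D * card B * (\<Sum>l\<in>L. (cmod (a l))\<^sup>2)"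
    using pos by (simp_all add: field_simps)
qed

lemma freq_upd_Suc:
  assumes "l \<in> digs L {1..n}"
  shows "freq R (l(Suc n := t)) = freq R l + prodRT R n *v t"
proof -
  have "freq R (l(Suc n := t)) = (\<Sum>k=1..Suc n. prodRT R (k - 1) *v (l(Suc n := t)) k)"
    by (rule freq_eq) (use assms in \<open>auto simp: digs_def\<close>)
  moreover have "freq R l = (\<Sum>k=1..n. prodRT R (k - 1) *v l k)"
    by (rule freq_eq) (use assms in \<open>auto simp: digs_def\<close>)
  ultimately show ?thesis by simp
qed

text \<open>The cross term of the old digits \<open>b\<close> with the new digit \<open>t\<close> is an integer.\<close>

lemma phase_upd_Suc:
  assumes inv: "\<And>j. j \<ge> 1 \<Longrightarrow> invertible (real_mat (R j))"
    and l: "l \<in> digs L {1..n}"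
  shows "phase R (Suc n) (b(Suc n := c)) (l(Suc n := t)) =
     phase R n b l * cis2pi (scaled R (Suc n) c \<bullet> real_vec (freq R l)) * digit_char (R (Suc n)) c t"
proof -
  define p where "p = real_vec (prodRT R n *v t)"
  have "scaled R k (b k) \<bullet> p \<in> \<int>" if "k \<in> {1..n}" for k
    unfolding p_def by (rule scaled_inner_prodRT_Ints[OF inv]) (use that in auto)
  then have Z: "psum R {1..n} b \<bullet> p \<in> \<int>"
    unfolding psum_def inner_sum_left by (rule Ints_sum)
  have s: "psum R {1..Suc n} (b(Suc n := c)) = psum R {1..n} b + scaled R (Suc n) c"
    by (simp add: psum_def)
  have f: "real_vec (freq R (l(Suc n := t))) = real_vec (freq R l) + p"
    unfolding p_def freq_upd_Suc[OF l] by (rule real_vec_simps(2))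
  have r: "digit_char (R (Suc n)) c t = cis2pi (scaled R (Suc n) c \<bullet> p)"
    unfolding digit_char_def p_def by (rule arg_cong[where f = cis2pi], rule scaled_inner_prodRT_Suc[OF inv, symmetric])
  show ?thesis
    unfolding phase_def s f r inner_add_left inner_add_right cis2pi_add cis2pi_Ints[OF Z] by simp
qed

lemma atLeastAtMost_Suc_insert: "{1..Suc n} = insert (Suc n) {1..n}"
  by auto

text \<open>The last digit is split off. With the old expansion \<open>l\<close> fixed, the triple
  of level \<open>Suc n\<close> is applied to the vector \<open>X l\<close> indexed by the new
  digits; with the new digit \<open>c\<close> fixed, the induction hypothesis is applied to the
  slice \<open>w' c\<close>. Exchanging the sums over \<open>l\<close> and \<open>c\<close> joins
  the two estimates. The factor \<open>M n\<close> compensates for the missing normalisation of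
  \<open>phase\<close>.\<close>

lemma frame_tower_level:
  fixes R :: "nat \<Rightarrow> int^'n^'n"
  assumes inv: "\<And>j. j \<ge> 1 \<Longrightarrow> invertible (real_mat (R j))"
    and B: "\<And>j. j \<ge> 1 \<Longrightarrow> finite (B j)" "\<And>j. j \<ge> 1 \<Longrightarrow> B j \<noteq> {}"
    and C: "\<And>j. j \<ge> 1 \<Longrightarrow> 0 \<le> C j" and D: "\<And>j. j \<ge> 1 \<Longrightarrow> 0 \<le> D j"
    and triple: "\<And>j. j \<ge> 1 \<Longrightarrow> frame_triple (R j) (B j) (L j) (C j) (D j)"
  defines "M \<equiv> \<lambda>n. real (card (digs B {1..n}))"
  shows "(\<Prod>k=1..n. C k) * M n * (\<Sum>b\<in>digs B {1..n}. (cmod (w b))\<^sup>2) \<le>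
      (\<Sum>l\<in>digs L {1..n}. (cmod (\<Sum>b\<in>digs B {1..n}. w b * cnj (phase R n b l)))\<^sup>2) \<and>
      (\<Sum>l\<in>digs L {1..n}. (cmod (\<Sum>b\<in>digs B {1..n}. w b * cnj (phase R n b l)))\<^sup>2) \<le>
      (\<Prod>k=1..n. D k) * M n * (\<Sum>b\<in>digs B {1..n}. (cmod (w b))\<^sup>2)"
    (is "?lo n w \<le> ?T n w \<and> _ \<le> ?up n w")
proof (induction n arbitrary: w)
  case 0
  show ?case by (simp add: M_def phase_def psum_def)
next
  case (Suc n)
  let ?A = "R (Suc n)" and ?B = "B (Suc n)" and ?L = "L (Suc n)"
  define w' where "w' c b = w (b(Suc n := c))" for c b
  \<comment> \<open>The leading factor couples the new digit \<open>c\<close> to the old frequency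
    and does not vanish from the exponent. It is unimodular and constant in \<open>b\<close> and
    \<open>t\<close>, so it drops out of \<open>cmod (X l c)\<close>, the only quantity on which the
    induction hypothesis is used.\<close>
  define X where "X l c = cnj (cis2pi (scaled R (Suc n) c \<bullet> real_vec (freq R l))) *
      (\<Sum>b\<in>digs B {1..n}. w' c b * cnj (phase R n b l))" for l c
  have [simp]: "Suc n \<notin> {1..n}" by simp
  have M: "M (Suc n) = M n * card ?B"
    by (simp add: M_def card_digs)
  have T: "?T (Suc n) w = (\<Sum>l\<in>digs L {1..n}. \<Sum>t\<in>?L. (cmod (\<Sum>c\<in>?B. X l c * cnj (digit_char ?A c t)))\<^sup>2)"
    unfolding atLeastAtMost_Suc_insert sum_digs_insert[OF \<open>Suc n \<notin> {1..n}\<close>]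
  proof (intro sum.cong refl arg_cong[where f="\<lambda>z. (cmod z)\<^sup>2"])
    fix l t assume l: "l \<in> digs L {1..n}"
    show "(\<Sum>b\<in>digs B {1..n}. \<Sum>c\<in>?B. w (b(Suc n := c)) * cnj (phase R (Suc n) (b(Suc n := c)) (l(Suc n := t)))) =
      (\<Sum>c\<in>?B. X l c * cnj (digit_char ?A c t))"
      by (subst sum.swap)
        (simp add: phase_upd_Suc[OF inv l] X_def w'_def sum_distrib_left sum_distrib_right mult_ac)
  qed
  have w: "(\<Sum>b\<in>digs B {1..Suc n}. (cmod (w b))\<^sup>2) = (\<Sum>c\<in>?B. \<Sum>b\<in>digs B {1..n}. (cmod (w' c b))\<^sup>2)"
    unfolding atLeastAtMost_Suc_insert sum_digs_insert[OF \<open>Suc n \<notin> {1..n}\<close>] w'_def by (rule sum.swap)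
  have X: "(\<Sum>l\<in>digs L {1..n}. \<Sum>c\<in>?B. (cmod (X l c))\<^sup>2) = (\<Sum>c\<in>?B. ?T n (w' c))"
    unfolding X_def by (subst sum.swap) (simp add: norm_mult)
  have tr: "C (Suc n) * card ?B * (\<Sum>c\<in>?B. (cmod (X l c))\<^sup>2) \<le> (\<Sum>t\<in>?L. (cmod (\<Sum>c\<in>?B. X l c * cnj (digit_char ?A c t)))\<^sup>2)"
    "(\<Sum>t\<in>?L. (cmod (\<Sum>c\<in>?B. X l c * cnj (digit_char ?A c t)))\<^sup>2) \<le> D (Suc n) * card ?B * (\<Sum>c\<in>?B. (cmod (X l c))\<^sup>2)" for l
    using frame_tripleD[OF triple[of "Suc n"]] B[of "Suc n"] by auto
  have "?lo (Suc n) w = C (Suc n) * card ?B * (\<Sum>c\<in>?B. ?lo n (w' c))"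
    unfolding w M by (simp add: sum_distrib_left mult_ac)
  also have "\<dots> \<le> C (Suc n) * card ?B * (\<Sum>c\<in>?B. ?T n (w' c))"
    by (intro mult_left_mono sum_mono) (use Suc.IH C in auto)
  also have "\<dots> \<le> ?T (Suc n) w"
    unfolding X[symmetric] T sum_distrib_left[of _ _ "digs L {1..n}"] by (intro sum_mono tr)
  finally have lo: "?lo (Suc n) w \<le> ?T (Suc n) w" .
  have "?T (Suc n) w \<le> D (Suc n) * card ?B * (\<Sum>c\<in>?B. ?T n (w' c))"
    unfolding X[symmetric] T sum_distrib_left[of _ _ "digs L {1..n}"] by (intro sum_mono tr)
  also have "\<dots> \<le> D (Suc n) * card ?B * (\<Sum>c\<in>?B. ?up n (w' c))"
    by (intro mult_left_mono sum_mono) (use Suc.IH D in auto)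
  also have "\<dots> = ?up (Suc n) w"
    unfolding w M by (simp add: sum_distrib_left mult_ac)
  finally show ?case using lo by simp
qed

text \<open>The free coefficients now sit on the frequency side, so from \<open>?T\<close> the two
  estimates come in the opposite order. With the new digit \<open>c\<close> fixed, the induction
  hypothesis is applied to the coefficients \<open>X c\<close>, in which the last frequency digit is
  already summed out; then, with the old expansion \<open>l\<close> fixed, the triple bounds the sum
  over \<open>c\<close>. \<open>S\<close> is the quantity between the two estimates.\<close>

lemma riesz_tower_level:
  fixes R :: "nat \<Rightarrow> int^'n^'n"
  assumes inv: "\<And>j. j \<ge> 1 \<Longrightarrow> invertible (real_mat (R j))"
    and B: "\<And>j. j \<ge> 1 \<Longrightarrow> finite (B j)" "\<And>j. j \<ge> 1 \<Longrightarrow> B j \<noteq> {}"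
    and C: "\<And>j. j \<ge> 1 \<Longrightarrow> 0 \<le> C j" and D: "\<And>j. j \<ge> 1 \<Longrightarrow> 0 \<le> D j"
    and triple: "\<And>j. j \<ge> 1 \<Longrightarrow> riesz_triple (R j) (B j) (L j) (C j) (D j)"
  defines "M \<equiv> \<lambda>n. real (card (digs B {1..n}))"
  shows "(\<Prod>k=1..n. C k) * M n * (\<Sum>l\<in>digs L {1..n}. (cmod (a l))\<^sup>2) \<le>
      (\<Sum>b\<in>digs B {1..n}. (cmod (\<Sum>l\<in>digs L {1..n}. a l * phase R n b l))\<^sup>2) \<and>
      (\<Sum>b\<in>digs B {1..n}. (cmod (\<Sum>l\<in>digs L {1..n}. a l * phase R n b l))\<^sup>2) \<le>
      (\<Prod>k=1..n. D k) * M n * (\<Sum>l\<in>digs L {1..n}. (cmod (a l))\<^sup>2)"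
    (is "?lo n a \<le> ?T n a \<and> _ \<le> ?up n a")
proof (induction n arbitrary: a)
  case 0
  show ?case by (simp add: M_def phase_def psum_def)
next
  case (Suc n)
  let ?A = "R (Suc n)" and ?B = "B (Suc n)" and ?L = "L (Suc n)"
  define X where "X c l = cis2pi (scaled R (Suc n) c \<bullet> real_vec (freq R l)) *
      (\<Sum>t\<in>?L. a (l(Suc n := t)) * digit_char ?A c t)" for l c
  define S where "S = (\<Sum>l\<in>digs L {1..n}. \<Sum>c\<in>?B. (cmod (\<Sum>t\<in>?L. a (l(Suc n := t)) * digit_char ?A c t))\<^sup>2)"
  have [simp]: "Suc n \<notin> {1..n}" by simp
  have M: "M (Suc n) = M n * card ?B"
    by (simp add: M_def card_digs)
  have T: "?T (Suc n) a = (\<Sum>c\<in>?B. ?T n (X c))"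
    unfolding atLeastAtMost_Suc_insert sum_digs_insert[OF \<open>Suc n \<notin> {1..n}\<close>]
  proof (subst sum.swap, intro sum.cong refl arg_cong[where f="\<lambda>z. (cmod z)\<^sup>2"])
    fix b c l assume l: "l \<in> digs L {1..n}"
    show "(\<Sum>t\<in>?L. a (l(Suc n := t)) * phase R (Suc n) (b(Suc n := c)) (l(Suc n := t))) =
      X c l * phase R n b l"
      by (simp add: phase_upd_Suc[OF inv l] X_def sum_distrib_left sum_distrib_right mult_ac)
  qed
  have a: "(\<Sum>l\<in>digs L {1..Suc n}. (cmod (a l))\<^sup>2) = (\<Sum>l\<in>digs L {1..n}. \<Sum>t\<in>?L. (cmod (a (l(Suc n := t))))\<^sup>2)"
    unfolding atLeastAtMost_Suc_insert sum_digs_insert[OF \<open>Suc n \<notin> {1..n}\<close>] ..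
  have X: "(\<Sum>c\<in>?B. \<Sum>l\<in>digs L {1..n}. (cmod (X c l))\<^sup>2) = S"
    unfolding X_def S_def by (subst sum.swap) (simp add: norm_mult)
  have S1: "C (Suc n) * card ?B * (\<Sum>l\<in>digs L {1..Suc n}. (cmod (a l))\<^sup>2) \<le> S"
    unfolding a S_def sum_distrib_left[of _ _ "digs L {1..n}"]
    by (intro sum_mono riesz_tripleD[OF triple[of "Suc n"]]) (use B in auto)
  have S2: "S \<le> D (Suc n) * card ?B * (\<Sum>l\<in>digs L {1..Suc n}. (cmod (a l))\<^sup>2)"
    unfolding a S_def sum_distrib_left[of _ _ "digs L {1..n}"]
    by (intro sum_mono riesz_tripleD[OF triple[of "Suc n"]]) (use B in auto)
  have MC: "0 \<le> (\<Prod>k=1..n. C k) * M n" and MD: "0 \<le> (\<Prod>k=1..n. D k) * M n"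
    using C D by (auto simp: M_def intro!: mult_nonneg_nonneg prod_nonneg)
  have "?lo (Suc n) a = (\<Prod>k=1..n. C k) * M n * (C (Suc n) * card ?B * (\<Sum>l\<in>digs L {1..Suc n}. (cmod (a l))\<^sup>2))"
    unfolding M by (simp add: mult_ac)
  also have "\<dots> \<le> (\<Prod>k=1..n. C k) * M n * S"
    by (rule mult_left_mono[OF S1 MC])
  also have "\<dots> \<le> ?T (Suc n) a"
    unfolding X[symmetric] T sum_distrib_left[of _ _ ?B] by (intro sum_mono) (use Suc.IH in auto)
  finally have lo: "?lo (Suc n) a \<le> ?T (Suc n) a" .
  have "?T (Suc n) a \<le> (\<Prod>k=1..n. D k) * M n * S"
    unfolding X[symmetric] T sum_distrib_left[of _ _ ?B] by (intro sum_mono) (use Suc.IH in auto)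
  also have "\<dots> \<le> (\<Prod>k=1..n. D k) * M n * (D (Suc n) * card ?B * (\<Sum>l\<in>digs L {1..Suc n}. (cmod (a l))\<^sup>2))"
    by (rule mult_left_mono[OF S2 MD])
  also have "\<dots> = ?up (Suc n) a"
    unfolding M by (simp add: mult_ac)
  finally show ?case using lo by simp
qed

section \<open>Approximation by continuous functions\<close>

definition bump :: "'a::metric_space set \<Rightarrow> nat \<Rightarrow> 'a \<Rightarrow> real" where
  "bump A k x = max 0 (1 - real k * infdist x A)"

lemma continuous_on_bump: "continuous_on S (bump A k)"
  unfolding bump_def by (intro continuous_intros)

lemma bump_bounds: "0 \<le> bump A k x" "bump A k x \<le> 1"
  by (auto simp: bump_def infdist_nonneg)

text \<open>Off a closed set the distance is positive, so the bump is 0 from some \<open>k\<close>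
  on. The empty set is excluded because \<open>infdist x {} = 0\<close> makes all its bumps equal to
  1; this also forces the case distinctions on \<open>K = {}\<close> further on.\<close>

lemma bump_tendsto_indicator:
  assumes "closed A" "A \<noteq> {}"
  shows "(\<lambda>k. bump A k x) \<longlonglongrightarrow> indicator A x"
proof (cases "x \<in> A")
  case True
  then show ?thesis by (simp add: bump_def)
next
  case False
  then have pos: "infdist x A > 0"
    using assms infdist_pos_not_in_closed by blast
  obtain k0 where k0: "1 < real k0 * infdist x A"
    using reals_Archimedean3[OF pos] by blast
  have "bump A k x = indicator A x" if "k \<ge> k0" for k
  proof -
    have "real k0 * infdist x A \<le> real k * infdist x A"
      using that pos by (intro mult_right_mono) auto
    then show ?thesis using k0 False by (simp add: bump_def)
  qed
  then show ?thesis
    by (intro tendsto_eventually eventually_sequentiallyI)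
qed

text \<open>Bumps are bounded and continuous and converge to indicators, so the two measures agree
  on compact sets; inner regularity carries this to all Borel sets. It yields the uniqueness of weak
  limits, without which the definite description in \<open>mu_gt\<close> could not be
  evaluated.\<close>

lemma prob_measure_eqI_bounded_continuous:
  fixes M N :: "'a::{second_countable_topology, complete_space} measure"
  assumes "prob_space M" "prob_space N" and sets: "sets M = sets borel" "sets N = sets borel"
    and eq: "\<And>f :: 'a \<Rightarrow> real. continuous_on UNIV f \<Longrightarrow> bounded (range f) \<Longrightarrow> (\<integral>x. f x \<partial>M) = (\<integral>x. f x \<partial>N)"
  shows "M = N"
proof -
  interpret M: prob_space M by fact
  interpret N: prob_space N by fact
  have lim: "(\<lambda>k. \<integral>x. bump K k x \<partial>P) \<longlonglongrightarrow> measure P K"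
    if "prob_space P" "sets P = sets borel" "compact K" "K \<noteq> {}" for P :: "'a measure" and K
  proof -
    interpret P: prob_space P by fact
    have K: "K \<in> sets P"
      using that by (simp add: compact_imp_closed borel_closed)
    have "(\<lambda>k. \<integral>x. bump K k x \<partial>P) \<longlonglongrightarrow> (\<integral>x. indicator K x \<partial>P)"
    proof (rule integral_dominated_convergence[where w="\<lambda>_. 1"])
      have "bump K k \<in> borel_measurable borel" for k
        by (rule borel_measurable_continuous_onI[OF continuous_on_bump])
      then show "bump K k \<in> borel_measurable P" for k
        using that(2) by (simp cong: measurable_cong_sets)
      show "AE x in P. (\<lambda>k. bump K k x) \<longlonglongrightarrow> indicator K x"
        by (intro AE_I2 bump_tendsto_indicator compact_imp_closed that)
      show "AE x in P. norm (bump K k x) \<le> 1" for k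
        using bump_bounds[of K k] by (intro AE_I2) auto
    qed (use K in auto)
    also have "(\<integral>x. indicator K x \<partial>P) = measure P K"
      using K P.emeasure_finite by (simp add: sets.Int_space_eq2)
    finally show ?thesis .
  qed
  have K: "emeasure M K = emeasure N K" if "compact K" for K
  proof (cases "K = {}")
    case False
    have "bounded (range (bump K k))" for k
      by (rule boundedI[where B=1]) (use bump_bounds[of K k] in auto)
    then have "(\<integral>x. bump K k x \<partial>M) = (\<integral>x. bump K k x \<partial>N)" for k
      by (intro eq continuous_on_bump)
    then have "measure M K = measure N K"
      using lim[OF assms(1) sets(1) that False] lim[OF assms(2) sets(2) that False]
      by (simp add: LIMSEQ_unique)
    then show ?thesis by (simp add: M.emeasure_eq_measure N.emeasure_eq_measure)
  qed simp
  show ?thesis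
  proof (rule measure_eqI)
    fix A assume "A \<in> sets M"
    then have A: "A \<in> sets borel" using sets by simp
    show "emeasure M A = emeasure N A"
      using inner_regular[OF sets(1) _ A] inner_regular[OF sets(2) _ A] K by simp
  qed (simp add: sets)
qed

lemma is_inf_conv_unique:
  assumes "is_inf_conv R B n M" "is_inf_conv R B n N"
  shows "M = N"
proof (rule prob_measure_eqI_bounded_continuous)
  fix f :: "real^'a \<Rightarrow> real" assume "continuous_on UNIV f" "bounded (range f)"
  then show "(\<integral>x. f x \<partial>M) = (\<integral>x. f x \<partial>N)"
    using assms unfolding is_inf_conv_def weak_limit_def by (meson LIMSEQ_unique)
qed (use assms in \<open>auto simp: is_inf_conv_def\<close>)

lemma mu_gt_eq: "is_inf_conv R B n M \<Longrightarrow> mu_gt R B n = M"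
  unfolding mu_gt_def by (rule the_equality) (auto intro: is_inf_conv_unique)

section \<open>Square integrable functions and the density of bounded continuous ones\<close>

lemma cmod_add_sq_le: "(cmod (a + b))\<^sup>2 \<le> 2 * (cmod a)\<^sup>2 + 2 * (cmod b)\<^sup>2"
proof -
  have "(cmod (a + b))\<^sup>2 \<le> (cmod a + cmod b)\<^sup>2"
    by (intro power_mono norm_triangle_ineq) auto
  also have "\<dots> \<le> 2 * (cmod a)\<^sup>2 + 2 * (cmod b)\<^sup>2"
    using zero_le_power2[of "cmod a - cmod b"] by (simp add: power2_eq_square algebra_simps)
  finally show ?thesis .
qed

lemma in_L2_integrable: "in_L2 M f \<Longrightarrow> integrable M (\<lambda>x. (cmod (f x))\<^sup>2)"
  by (simp add: in_L2_def)

lemma in_L2_add: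
  assumes "in_L2 M f" "in_L2 M g"
  shows "in_L2 M (\<lambda>x. f x + g x)"
proof -
  have [measurable]: "f \<in> borel_measurable M" "g \<in> borel_measurable M"
    using assms by (auto simp: in_L2_def)
  have "integrable M (\<lambda>x. (cmod (f x + g x))\<^sup>2)"
  proof (rule Bochner_Integration.integrable_bound)
    show "integrable M (\<lambda>x. 2 * (cmod (f x))\<^sup>2 + 2 * (cmod (g x))\<^sup>2)"
      using assms by (auto simp: in_L2_def)
    have "(cmod (f x + g x))\<^sup>2 \<le> norm (2 * (cmod (f x))\<^sup>2 + 2 * (cmod (g x))\<^sup>2)" for x
      using cmod_add_sq_le[of "f x" "g x"] by simp
    then show "AE x in M. norm ((cmod (f x + g x))\<^sup>2) \<le> norm (2 * (cmod (f x))\<^sup>2 + 2 * (cmod (g x))\<^sup>2)"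
      by simp
  qed measurable
  then show ?thesis by (simp add: in_L2_def)
qed

lemma in_L2_cmult:
  assumes "in_L2 M f"
  shows "in_L2 M (\<lambda>x. c * f x)"
  using assms by (auto simp: in_L2_def norm_mult power_mult_distrib)

lemma in_L2_diff:
  assumes "in_L2 M f" "in_L2 M g"
  shows "in_L2 M (\<lambda>x. f x - g x)"
  using in_L2_add[OF assms(1) in_L2_cmult[OF assms(2), of "-1"]] by simp

lemma (in finite_measure) in_L2_bounded:
  assumes "f \<in> borel_measurable M" "\<And>x. x \<in> space M \<Longrightarrow> cmod (f x) \<le> c"
  shows "in_L2 M f"
proof -
  have "integrable M (\<lambda>x. (cmod (f x))\<^sup>2)"
    by (rule integrable_const_bound[where B="c\<^sup>2"])
      (use assms in \<open>auto intro!: AE_I2 power_mono simp: norm_power\<close>)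
  then show ?thesis using assms by (simp add: in_L2_def)
qed

lemma in_L2_mult_bounded:
  assumes "in_L2 M f" "g \<in> borel_measurable M" "\<And>x. x \<in> space M \<Longrightarrow> cmod (g x) \<le> 1"
  shows "in_L2 M (\<lambda>x. f x * g x)"
proof -
  have [measurable]: "f \<in> borel_measurable M" "g \<in> borel_measurable M"
    using assms by (auto simp: in_L2_def)
  have "integrable M (\<lambda>x. (cmod (f x * g x))\<^sup>2)"
  proof (rule Bochner_Integration.integrable_bound)
    show "integrable M (\<lambda>x. (cmod (f x))\<^sup>2)"
      using assms by (auto simp: in_L2_def)
    have "(cmod (f x * g x))\<^sup>2 \<le> (cmod (f x))\<^sup>2" if "x \<in> space M" for x
      using assms(3)[OF that] by (intro power_mono) (auto simp: norm_mult mult_left_le)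
    then show "AE x in M. norm ((cmod (f x * g x))\<^sup>2) \<le> norm ((cmod (f x))\<^sup>2)"
      by (intro AE_I2) simp
  qed measurable
  then show ?thesis by (simp add: in_L2_def)
qed

lemma (in finite_measure) in_L2_imp_integrable:
  assumes "in_L2 M f"
  shows "integrable M f"
proof (rule Bochner_Integration.integrable_bound)
  show "integrable M (\<lambda>x. 1 + (cmod (f x))\<^sup>2)"
    using assms by (auto simp: in_L2_def)
  have "cmod z \<le> 1 + (cmod z)\<^sup>2" for z
    using zero_le_power2[of "cmod z - 1"] zero_le_power2[of "cmod z"]
    unfolding power2_diff one_power2 mult_1_right by linarith
  then show "AE x in M. norm (f x) \<le> norm (1 + (cmod (f x))\<^sup>2)" by simp
qed (use assms in \<open>simp add: in_L2_def\<close>)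

text \<open>After the norm is moved inside the integral, the claim is that the variance of
  \<open>cmod (f x)\<close> is nonnegative.\<close>

lemma (in prob_space) cmod_expectation_sq_le:
  assumes "in_L2 M f"
  shows "(cmod (\<integral>x. f x \<partial>M))\<^sup>2 \<le> (\<integral>x. (cmod (f x))\<^sup>2 \<partial>M)"
proof -
  have i: "integrable M f" by (rule in_L2_imp_integrable[OF assms])
  have "(cmod (\<integral>x. f x \<partial>M))\<^sup>2 \<le> (\<integral>x. cmod (f x) \<partial>M)\<^sup>2"
    by (intro power_mono integral_norm_bound) auto
  also have "\<dots> \<le> (\<integral>x. (cmod (f x))\<^sup>2 \<partial>M)"
    using variance_eq[of "\<lambda>x. cmod (f x)"] variance_positive[of "\<lambda>x. cmod (f x)"] i in_L2_integrable[OF assms] by simp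
  finally show ?thesis .
qed

text \<open>Membership in the \<open>L\<^sup>2\<close> closure of the bounded continuous functions.
  Closure under limits, sums and multiples reduces density to indicators.\<close>

definition cont_approx :: "'a::topological_space measure \<Rightarrow> ('a \<Rightarrow> complex) \<Rightarrow> bool" where
  "cont_approx M f \<longleftrightarrow> in_L2 M f \<and>
     (\<forall>\<epsilon>>0. \<exists>g. continuous_on UNIV g \<and> bounded (range g) \<and> (\<integral>x. (cmod (f x - g x))\<^sup>2 \<partial>M) < \<epsilon>)"

lemma in_L2_bounded_continuous:
  fixes g :: "'a::topological_space \<Rightarrow> complex"
  assumes "finite_measure M" "sets M = sets borel" "continuous_on UNIV g" "bounded (range g)"
  shows "in_L2 M g"
proof -
  interpret finite_measure M by fact
  obtain c where "\<And>x. cmod (g x) \<le> c"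
    using assms(4) by (auto simp: bounded_iff)
  moreover have "g \<in> borel_measurable M"
    using borel_measurable_continuous_onI[OF assms(3)] assms(2) by (simp cong: measurable_cong_sets)
  ultimately show ?thesis by (intro in_L2_bounded)
qed

lemma integral_cmod_add_sq_le:
  assumes "in_L2 M f" "in_L2 M g"
  shows "(\<integral>x. (cmod (f x + g x))\<^sup>2 \<partial>M) \<le> 2 * (\<integral>x. (cmod (f x))\<^sup>2 \<partial>M) + 2 * (\<integral>x. (cmod (g x))\<^sup>2 \<partial>M)"
proof -
  note i = in_L2_integrable[OF assms(1)] in_L2_integrable[OF assms(2)] in_L2_integrable[OF in_L2_add[OF assms]]
  have "(\<integral>x. (cmod (f x + g x))\<^sup>2 \<partial>M) \<le> (\<integral>x. 2 * (cmod (f x))\<^sup>2 + 2 * (cmod (g x))\<^sup>2 \<partial>M)"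
    by (intro integral_mono cmod_add_sq_le) (use i in auto)
  then show ?thesis using i by simp
qed

lemma cont_approx_closure:
  assumes "finite_measure M" "sets M = sets borel" "in_L2 M f"
    and "\<And>\<epsilon>. \<epsilon> > 0 \<Longrightarrow> \<exists>g. cont_approx M g \<and> (\<integral>x. (cmod (f x - g x))\<^sup>2 \<partial>M) < \<epsilon>"
  shows "cont_approx M f"
  unfolding cont_approx_def
proof (intro conjI allI impI)
  fix \<epsilon> :: real assume "\<epsilon> > 0"
  then obtain g where g: "cont_approx M g" "(\<integral>x. (cmod (f x - g x))\<^sup>2 \<partial>M) < \<epsilon> / 4"
    \<comment> \<open>The crude inequality \<open>cmod_add_sq_le\<close> doubles both errors, so
      each may be at most a quarter. Constants are irrelevant for density.\<close>
    using assms(4)[of "\<epsilon> / 4"] by auto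
  then obtain h where h: "continuous_on UNIV h" "bounded (range h)" "(\<integral>x. (cmod (g x - h x))\<^sup>2 \<partial>M) < \<epsilon> / 4"
    using \<open>\<epsilon> > 0\<close> unfolding cont_approx_def by (meson divide_pos_pos zero_less_numeral)
  have gL: "in_L2 M g" using g by (simp add: cont_approx_def)
  have hL: "in_L2 M h" by (rule in_L2_bounded_continuous[OF assms(1,2) h(1,2)])
  have "(\<integral>x. (cmod (f x - h x))\<^sup>2 \<partial>M) < \<epsilon>"
    using integral_cmod_add_sq_le[OF in_L2_diff[OF assms(3) gL] in_L2_diff[OF gL hL]] g(2) h(3) by simp
  then show "\<exists>g. continuous_on UNIV g \<and> bounded (range g) \<and> (\<integral>x. (cmod (f x - g x))\<^sup>2 \<partial>M) < \<epsilon>"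
    using h by blast
qed fact

lemma cont_approx_add:
  assumes "finite_measure M" "sets M = sets borel" "cont_approx M f" "cont_approx M f'"
  shows "cont_approx M (\<lambda>x. f x + f' x)"
  unfolding cont_approx_def
proof (intro conjI allI impI)
  have L: "in_L2 M f" "in_L2 M f'" using assms by (auto simp: cont_approx_def)
  then show "in_L2 M (\<lambda>x. f x + f' x)" by (rule in_L2_add)
  fix \<epsilon> :: real assume "\<epsilon> > 0"
  then have "\<epsilon> / 4 > 0" by simp
  obtain g where g: "continuous_on UNIV g" "bounded (range g)" "(\<integral>x. (cmod (f x - g x))\<^sup>2 \<partial>M) < \<epsilon> / 4"
    using assms(3) \<open>\<epsilon> / 4 > 0\<close> unfolding cont_approx_def by blast
  obtain g' where g': "continuous_on UNIV g'" "bounded (range g')" "(\<integral>x. (cmod (f' x - g' x))\<^sup>2 \<partial>M) < \<epsilon> / 4"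
    using assms(4) \<open>\<epsilon> / 4 > 0\<close> unfolding cont_approx_def by blast
  have gL: "in_L2 M g" "in_L2 M g'"
    using in_L2_bounded_continuous[OF assms(1,2)] g g' by auto
  have "(\<integral>x. (cmod ((f x - g x) + (f' x - g' x)))\<^sup>2 \<partial>M) < \<epsilon>"
    using integral_cmod_add_sq_le[OF in_L2_diff[OF L(1) gL(1)] in_L2_diff[OF L(2) gL(2)]] g(3) g'(3) by simp
  moreover have "(f x - g x) + (f' x - g' x) = f x + f' x - (g x + g' x)" for x by simp
  ultimately have "(\<integral>x. (cmod (f x + f' x - (g x + g' x)))\<^sup>2 \<partial>M) < \<epsilon>" by simp
  then show "\<exists>h. continuous_on UNIV h \<and> bounded (range h) \<and> (\<integral>x. (cmod (f x + f' x - h x))\<^sup>2 \<partial>M) < \<epsilon>"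
    using g g' by (intro exI[of _ "\<lambda>x. g x + g' x"] conjI continuous_intros bounded_plus_comp)
qed

lemma cont_approx_cmult:
  assumes "cont_approx M f"
  shows "cont_approx M (\<lambda>x. c * f x)"
  unfolding cont_approx_def
proof (intro conjI allI impI)
  show "in_L2 M (\<lambda>x. c * f x)" using assms by (auto simp: cont_approx_def intro: in_L2_cmult)
  fix \<epsilon> :: real assume "\<epsilon> > 0"
  \<comment> \<open>The summand 1 covers the case \<open>c = 0\<close>.\<close>
  then have e: "\<epsilon> / ((cmod c)\<^sup>2 + 1) > 0" by (simp add: add_nonneg_pos)
  obtain g where g: "continuous_on UNIV g" "bounded (range g)" "(\<integral>x. (cmod (f x - g x))\<^sup>2 \<partial>M) < \<epsilon> / ((cmod c)\<^sup>2 + 1)"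
    using assms e unfolding cont_approx_def by blast
  have "(\<integral>x. (cmod (c * f x - c * g x))\<^sup>2 \<partial>M) = (cmod c)\<^sup>2 * (\<integral>x. (cmod (f x - g x))\<^sup>2 \<partial>M)"
    by (simp add: norm_mult power_mult_distrib flip: right_diff_distrib)
  also have "\<dots> \<le> ((cmod c)\<^sup>2 + 1) * (\<integral>x. (cmod (f x - g x))\<^sup>2 \<partial>M)"
    by (intro mult_right_mono integral_nonneg_AE) auto
  also have "\<dots> < \<epsilon>"
    using g(3) by (simp add: pos_less_divide_eq add_nonneg_pos mult.commute)
  finally have "(\<integral>x. (cmod (c * f x - c * g x))\<^sup>2 \<partial>M) < \<epsilon>" .
  moreover have "bounded (range (\<lambda>x. c * g x))"
    using bounded_scaling[of "range g"] g(2) bounded_linear_image[OF g(2) bounded_linear_mult_right[of c]]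
    by (simp add: image_image)
  ultimately show "\<exists>h. continuous_on UNIV h \<and> bounded (range h) \<and> (\<integral>x. (cmod (c * f x - h x))\<^sup>2 \<partial>M) < \<epsilon>"
    using g by (intro exI[of _ "\<lambda>x. c * g x"] conjI continuous_intros)
qed

text \<open>Compact sets are handled by their bumps. A Borel set \<open>A\<close> contains a compact
  \<open>K\<close> of nearly the same measure, and the squared \<open>L\<^sup>2\<close> distance of
  the two indicators is exactly \<open>measure M A - measure M K\<close>.\<close>

lemma cont_approx_indicator:
  fixes M :: "'a::{second_countable_topology, complete_space} measure"
  assumes "finite_measure M" and sets: "sets M = sets borel" and A: "A \<in> sets M"
  shows "cont_approx M (indicator A)"
proof -
  interpret finite_measure M by fact
  have L: "in_L2 M (indicator A)" if "A \<in> sets M" for A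
    by (rule in_L2_bounded[where c=1]) (use that in \<open>auto simp: indicator_def\<close>)
  have K: "cont_approx M (indicator K)" if "compact K" for K
    unfolding cont_approx_def
  proof (intro conjI allI impI)
    have K: "K \<in> sets M" using that sets by (simp add: compact_imp_closed borel_closed)
    then show "in_L2 M (indicator K)" by (rule L)
    fix \<epsilon> :: real assume "\<epsilon> > 0"
    show "\<exists>g. continuous_on UNIV g \<and> bounded (range g) \<and> (\<integral>x. (cmod (indicator K x - g x))\<^sup>2 \<partial>M) < \<epsilon>"
    proof (cases "K = {}")
      case True
      then show ?thesis using \<open>\<epsilon> > 0\<close>
        by (intro exI[of _ "\<lambda>_. 0"]) auto
    next
      case False
      have [measurable]: "bump K k \<in> borel_measurable M" for k
        using borel_measurable_continuous_onI[OF continuous_on_bump] sets by (simp cong: measurable_cong_sets)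
      have "(\<lambda>k. \<integral>x. (cmod (indicator K x - of_real (bump K k x)))\<^sup>2 \<partial>M) \<longlonglongrightarrow> (\<integral>x. 0 \<partial>M)"
      proof (rule integral_dominated_convergence[where w="\<lambda>_. 1"])
        show "AE x in M. (\<lambda>k. (cmod (indicator K x - of_real (bump K k x)))\<^sup>2) \<longlonglongrightarrow> 0"
        proof (intro AE_I2)
          fix x
          have "(\<lambda>k. (cmod (indicator K x - of_real (bump K k x)))\<^sup>2) \<longlonglongrightarrow>
            (cmod (indicator K x - of_real (indicator K x)))\<^sup>2"
            by (intro tendsto_intros bump_tendsto_indicator compact_imp_closed that False)
          then show "(\<lambda>k. (cmod (indicator K x - of_real (bump K k x)))\<^sup>2) \<longlonglongrightarrow> 0"
            by (simp only: of_real_indicator diff_self norm_zero zero_power2)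
        qed
        show "AE x in M. norm ((cmod (indicator K x - of_real (bump K k x)))\<^sup>2) \<le> 1" for k
        proof (intro AE_I2)
          fix x
          have "cmod (indicator K x - of_real (bump K k x)) = \<bar>indicator K x - bump K k x\<bar>"
            unfolding norm_of_real[symmetric, where 'a=complex] by (simp add: indicator_def)
          also have "\<dots> \<le> 1"
            using bump_bounds[of K k x] by (auto simp: indicator_def)
          finally show "norm ((cmod (indicator K x - of_real (bump K k x)))\<^sup>2) \<le> 1"
            by (simp add: power_le_one)
        qed
      qed (use K in auto)
      then have "\<forall>\<^sub>F k in sequentially. (\<integral>x. (cmod (indicator K x - of_real (bump K k x)))\<^sup>2 \<partial>M) < \<epsilon>"
        using \<open>\<epsilon> > 0\<close> by (simp add: order_tendstoD)
      then obtain k where k: "(\<integral>x. (cmod (indicator K x - of_real (bump K k x)))\<^sup>2 \<partial>M) < \<epsilon>"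
        using eventually_sequentially by auto
      have "bounded (range (\<lambda>x. complex_of_real (bump K k x)))"
        by (rule boundedI[where B=1]) (use bump_bounds[of K k] in auto)
      then show ?thesis using k
        by (intro exI[of _ "\<lambda>x. of_real (bump K k x)"] conjI continuous_on_of_real continuous_on_bump)
    qed
  qed
  show ?thesis
  proof (rule cont_approx_closure[OF assms(1,2) L[OF A]])
    fix \<epsilon> :: real assume \<epsilon>: "\<epsilon> > 0"
    have inn: "emeasure M A = (SUP K\<in>{K. K \<subseteq> A \<and> compact K}. emeasure M K)"
      by (rule inner_regular[OF sets]) (use A sets in auto)
    have "\<exists>K. K \<subseteq> A \<and> compact K \<and> measure M A - \<epsilon> < measure M K"
    \<comment> \<open>Inner regularity is stated in \<open>ennreal\<close>, where a negative
      difference would be cut off to 0; in that case the empty set already serves.\<close>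
    proof (cases "measure M A - \<epsilon> < 0")
      case True
      then show ?thesis by (intro exI[of _ "{}"]) auto
    next
      case False
      then have "ennreal (measure M A - \<epsilon>) < emeasure M A"
        using \<epsilon> by (simp add: emeasure_eq_measure ennreal_less_iff)
      then obtain K where "K \<subseteq> A" "compact K" "ennreal (measure M A - \<epsilon>) < emeasure M K"
        unfolding inn less_SUP_iff by auto
      then show ?thesis
        using False by (auto simp: emeasure_eq_measure ennreal_less_iff)
    qed
    then obtain K where K': "K \<subseteq> A" "compact K" "measure M A - \<epsilon> < measure M K" by blast
    have KM: "K \<in> sets M" using K' sets by (simp add: compact_imp_closed borel_closed)
    have "(\<integral>x. (cmod (indicator A x - indicator K x))\<^sup>2 \<partial>M) = (\<integral>x. indicator (A - K) x \<partial>M)"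
      by (intro Bochner_Integration.integral_cong) (use K'(1) in \<open>auto simp: indicator_def\<close>)
    also have "\<dots> = measure M A - measure M K"
      using A KM K'(1) by (simp add: finite_measure_Diff sets.Int_space_eq2)
    finally show "\<exists>g. cont_approx M g \<and> (\<integral>x. (cmod (indicator A x - g x))\<^sup>2 \<partial>M) < \<epsilon>"
      using K[OF K'(2)] K'(3) by (intro exI[of _ "indicator K"]) auto
  qed
qed

lemma in_L2_imp_cont_approx:
  fixes M :: "'a::{second_countable_topology, complete_space} measure"
  assumes "finite_measure M" and sets: "sets M = sets borel" and f: "in_L2 M f"
  shows "cont_approx M f"
proof (rule cont_approx_closure[OF assms])
  fix \<epsilon> :: real assume \<epsilon>: "\<epsilon> > 0"
  interpret finite_measure M by fact
  have [measurable]: "f \<in> borel_measurable M" using f by (simp add: in_L2_def)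
  obtain F where F: "\<And>i. simple_function M (F i)" "\<And>x. x \<in> space M \<Longrightarrow> (\<lambda>i. F i x) \<longlonglongrightarrow> f x"
      "\<And>i x. x \<in> space M \<Longrightarrow> cmod (F i x) \<le> 2 * cmod (f x)"
    using borel_measurable_implies_sequence_metric[of f M 0] by (simp add: dist_norm) metis
  have [measurable]: "F i \<in> borel_measurable M" for i
    by (rule borel_measurable_simple_function[OF F(1)])
  have "(\<lambda>i. \<integral>x. (cmod (f x - F i x))\<^sup>2 \<partial>M) \<longlonglongrightarrow> (\<integral>x. 0 \<partial>M)"
  \<comment> \<open>The simple functions satisfy \<open>cmod (F i x) \<le> 2 * cmod (f x)\<close>,
    so the difference is at most three times \<open>cmod (f x)\<close>; 9 is the square of
    3.\<close>
  proof (rule integral_dominated_convergence[where w="\<lambda>x. 9 * (cmod (f x))\<^sup>2"])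
    show "AE x in M. (\<lambda>i. (cmod (f x - F i x))\<^sup>2) \<longlonglongrightarrow> 0"
    proof (intro AE_I2)
      fix x assume "x \<in> space M"
      then have "(\<lambda>i. (cmod (f x - F i x))\<^sup>2) \<longlonglongrightarrow> (cmod (f x - f x))\<^sup>2"
        by (intro tendsto_intros F)
      then show "(\<lambda>i. (cmod (f x - F i x))\<^sup>2) \<longlonglongrightarrow> 0" by simp
    qed
    show "AE x in M. norm ((cmod (f x - F i x))\<^sup>2) \<le> 9 * (cmod (f x))\<^sup>2" for i
    proof (intro AE_I2)
      fix x assume "x \<in> space M"
      then have "cmod (f x - F i x) \<le> 3 * cmod (f x)"
        using norm_triangle_ineq4[of "f x" "F i x"] F(3)[of x i] by simp
      then have "(cmod (f x - F i x))\<^sup>2 \<le> (3 * cmod (f x))\<^sup>2"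
        by (intro power_mono) auto
      then show "norm ((cmod (f x - F i x))\<^sup>2) \<le> 9 * (cmod (f x))\<^sup>2"
        by (simp add: power_mult_distrib)
    qed
  qed (use in_L2_integrable[OF f] in auto)
  then have "\<forall>\<^sub>F i in sequentially. (\<integral>x. (cmod (f x - F i x))\<^sup>2 \<partial>M) < \<epsilon>"
    using \<epsilon> by (simp add: order_tendstoD)
  then obtain i where i: "(\<integral>x. (cmod (f x - F i x))\<^sup>2 \<partial>M) < \<epsilon>"
    using eventually_sequentially by auto
  define S where "S = F i ` space M"
  have fin: "finite S" and meas: "\<And>y. F i -` {y} \<inter> space M \<in> sets M"
    using F(1)[of i] simple_functionD by (auto simp: S_def)
  have "cont_approx M (\<lambda>x. \<Sum>y\<in>T. y * indicator (F i -` {y} \<inter> space M) x)" if "finite T" for T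
    using that
  proof induction
    case empty
    have "in_L2 M (\<lambda>_. 0)" by (rule in_L2_bounded[where c=0]) auto
    then show ?case
      unfolding cont_approx_def by (auto intro!: exI[of _ "\<lambda>_. 0"])
  next
    case (insert y T)
    show ?case
      unfolding sum.insert[OF insert.hyps]
      by (intro cont_approx_add assms(1,2) cont_approx_cmult cont_approx_indicator meas insert.IH)
  qed
  moreover have "(\<Sum>y\<in>S. y * indicator (F i -` {y} \<inter> space M) x) = F i x" if "x \<in> space M" for x
  proof -
    have "(\<Sum>y\<in>S. y * indicator (F i -` {y} \<inter> space M) x) = (\<Sum>y\<in>{F i x}. y * indicator (F i -` {y} \<inter> space M) x)"
      by (rule sum.mono_neutral_right) (use fin that in \<open>auto simp: S_def indicator_def\<close>)
    then show ?thesis using that by simp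
  qed
  then have "(\<integral>x. (cmod (f x - (\<Sum>y\<in>S. y * indicator (F i -` {y} \<inter> space M) x)))\<^sup>2 \<partial>M) =
      (\<integral>x. (cmod (f x - F i x))\<^sup>2 \<partial>M)"
    by (intro Bochner_Integration.integral_cong) auto
  ultimately show "\<exists>g. cont_approx M g \<and> (\<integral>x. (cmod (f x - g x))\<^sup>2 \<partial>M) < \<epsilon>"
    using i fin by (intro exI[of _ "\<lambda>x. \<Sum>y\<in>S. y * indicator (F i -` {y} \<inter> space M) x"]) auto
qed

section \<open>The infinite convolution as a law on digit sequences\<close>

lemma prob_space_fin_conv:
  fixes B :: "nat \<Rightarrow> (int^'n) set"
  assumes "\<And>j. j \<ge> 1 \<Longrightarrow> finite (B j)" "\<And>j. j \<ge> 1 \<Longrightarrow> B j \<noteq> {}"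
  shows "prob_space (fin_conv R B n m) \<and> sets (fin_conv R B n m) = sets borel"
proof (induction m)
  case 0
  show ?case by (simp add: prob_space_return)
next
  case (Suc m)
  define U where "U = unif (scaled R (n + Suc m) ` B (n + Suc m))"
  interpret M: prob_space "fin_conv R B n m" using Suc by simp
  interpret U: prob_space U
    unfolding unif_def U_def by (intro measure_pmf.prob_space_distr) simp
  interpret P: pair_prob_space "fin_conv R B n m" U ..
  have [measurable_cong]: "sets (fin_conv R B n m) = sets borel" "sets U = sets borel"
    using Suc by (auto simp: unif_def U_def)
  have "prob_space (distr (fin_conv R B n m \<Otimes>\<^sub>M U) borel (\<lambda>(x, y). x + y))"
    by (rule P.prob_space_distr) measurable
  then show ?case
    by (simp add: convolution_def U_def)
qed

lemma integral_unif:
  fixes f :: "real^'n \<Rightarrow> real"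
  assumes "finite A" "A \<noteq> {}" "f \<in> borel_measurable borel"
  shows "(\<integral>x. f x \<partial>unif A) = (\<Sum>a\<in>A. f a) / card A"
  using assms unfolding unif_def by (simp add: integral_distr integral_pmf_of_set)

lemma integral_fin_conv_Suc:
  fixes f :: "real^'n \<Rightarrow> real"
  assumes inv: "\<And>j. j \<ge> 1 \<Longrightarrow> invertible (real_mat (R j))"
    and B: "\<And>j. j \<ge> 1 \<Longrightarrow> finite (B j)" "\<And>j. j \<ge> 1 \<Longrightarrow> B j \<noteq> {}"
    and f [measurable]: "f \<in> borel_measurable borel" and bd: "\<And>x. \<bar>f x\<bar> \<le> c"
  shows "(\<integral>x. f x \<partial>fin_conv R B n (Suc m)) =
    (\<integral>x. (\<Sum>t\<in>B (n + Suc m). f (x + scaled R (n + Suc m) t)) / card (B (n + Suc m)) \<partial>fin_conv R B n m)"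
proof -
  define M U where "M = fin_conv R B n m" and "U = unif (scaled R (n + Suc m) ` B (n + Suc m))"
  note pM = prob_space_fin_conv[of B, OF B, of R n m, folded M_def, simplified]
  interpret M: prob_space M using pM by simp
  interpret U: prob_space U
    unfolding unif_def U_def by (intro measure_pmf.prob_space_distr) simp
  interpret P: pair_prob_space M U ..
  have [measurable_cong]: "sets M = sets borel" "sets U = sets borel"
    using pM by (auto simp: unif_def U_def)
  have "(\<integral>x. f x \<partial>fin_conv R B n (Suc m)) = (\<integral>x. f x \<partial>distr (M \<Otimes>\<^sub>M U) borel (\<lambda>(x, y). x + y))"
    by (simp add: convolution_def M_def U_def)
  also have "\<dots> = (\<integral>z. f (fst z + snd z) \<partial>(M \<Otimes>\<^sub>M U))"
    by (subst integral_distr) (measurable, simp add: case_prod_beta)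
  also have "\<dots> = (\<integral>x. \<integral>y. f (x + y) \<partial>U \<partial>M)"
    by (subst P.integral_fst'[symmetric])
      (auto intro!: P.P.integrable_const_bound[where B=c] simp: bd)
  also have "\<dots> = (\<integral>x. (\<Sum>t\<in>B (n + Suc m). f (x + scaled R (n + Suc m) t)) / card (B (n + Suc m)) \<partial>M)"
    unfolding U_def
    by (simp add: integral_unif B sum.reindex[OF inj_scaled[of R, OF inv]]
        card_image[OF inj_scaled[of R, OF inv]])
  finally show ?thesis unfolding M_def .
qed

lemma psum_insert: "finite J \<Longrightarrow> k \<notin> J \<Longrightarrow> psum R (insert k J) (b(k := t)) = psum R J b + scaled R k t"
  by (auto simp: psum_def intro!: sum.cong)

lemma psum_trunc [simp]: "psum R J (trunc J b) = psum R J b"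
  by (simp add: psum_def trunc_def)

text \<open>Integration against the finite convolution is the average over all choices of digits.
  Each step replaces \<open>f\<close> by its average over the outermost digit, so \<open>f\<close>
  has to be arbitrary in the induction.\<close>

lemma integral_fin_conv:
  fixes f :: "real^'n \<Rightarrow> real"
  assumes inv: "\<And>j. j \<ge> 1 \<Longrightarrow> invertible (real_mat (R j))"
    and B: "\<And>j. j \<ge> 1 \<Longrightarrow> finite (B j)" "\<And>j. j \<ge> 1 \<Longrightarrow> B j \<noteq> {}"
    and "f \<in> borel_measurable borel" and "\<And>x. \<bar>f x\<bar> \<le> c"
  shows "(\<integral>x. f x \<partial>fin_conv R B n m) =
    (\<Sum>b\<in>digs B {n<..n+m}. f (psum R {n<..n+m} b)) / card (digs B {n<..n+m})"
  using assms(4,5)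
proof (induction m arbitrary: f)
  case 0
  then show ?case by (simp add: integral_return psum_def)
next
  case (Suc m)
  let ?k = "n + Suc m"
  let ?g = "\<lambda>x. (\<Sum>t\<in>B ?k. f (x + scaled R ?k t)) / card (B ?k)"
  note [measurable] = Suc.prems(1)
  have "card (B ?k) > 0" using B[of ?k] by (simp add: card_gt_0_iff)
  \<comment> \<open>An average is bounded by the same constant, so the induction hypothesis applies
    to \<open>?g\<close> with the same \<open>c\<close>.\<close>
  have "(\<Sum>t\<in>B ?k. \<bar>f (x + scaled R ?k t)\<bar>) \<le> card (B ?k) * c" for x
    by (rule sum_bounded_above) (rule Suc.prems)
  then have g: "\<bar>?g x\<bar> \<le> c" for x
    using order_trans[OF sum_abs, of "\<lambda>t. f (x + scaled R ?k t)" "B ?k" "card (B ?k) * c"] \<open>card (B ?k) > 0\<close>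
    by (simp add: divide_le_eq mult.commute)
  have ins: "{n<..n + Suc m} = insert ?k {n<..n+m}" "?k \<notin> {n<..n+m}" by auto
  have "(\<integral>x. f x \<partial>fin_conv R B n (Suc m)) = (\<integral>x. ?g x \<partial>fin_conv R B n m)"
    by (rule integral_fin_conv_Suc[OF inv B Suc.prems])
  also have "\<dots> = (\<Sum>b\<in>digs B {n<..n+m}. ?g (psum R {n<..n+m} b)) / card (digs B {n<..n+m})"
    by (rule Suc.IH) (use g in auto)
  also have "\<dots> = (\<Sum>b\<in>digs B {n<..n + Suc m}. f (psum R {n<..n + Suc m} b)) / card (digs B {n<..n + Suc m})"
    unfolding ins(1) sum_digs_insert[OF ins(2)] psum_insert[OF finite_greaterThanAtMost ins(2)]
    by (simp add: card_digs ins(2) mult.commute flip: sum_divide_distrib)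
  finally show ?case .
qed

section \<open>The product space of the digits and the sum of the digit series\<close>

locale digit_convolution =
  fixes R :: "nat \<Rightarrow> int^'n^'n" and B :: "nat \<Rightarrow> (int^'n) set"
  assumes inv: "\<And>j. j \<ge> 1 \<Longrightarrow> invertible (real_mat (R j))"
    and finite_B: "\<And>j. j \<ge> 1 \<Longrightarrow> finite (B j)"
    and zero_B: "\<And>j. j \<ge> 1 \<Longrightarrow> 0 \<in> B j"
    and series_converge: "series_converge R B"
begin

text \<open>Index \<open>0\<close> carries no digit, but \<open>B 0\<close> is unconstrained and may be empty or infinite.\<close>

definition B0 :: "nat \<Rightarrow> (int^'n) set" where
  "B0 k = (if k = 0 then {0} else B k)"

text \<open>Each factor has \<open>B0 k\<close> itself as its space, so every point of
  \<open>space Om\<close> is an admissible digit sequence. The digit series therefore converges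
  everywhere on the space and not merely almost everywhere.\<close>

definition Om :: "(nat \<Rightarrow> int^'n) measure" where
  "Om = (\<Pi>\<^sub>M k\<in>UNIV. uniform_count_measure (B0 k))"

lemma B0: "finite (B0 k)" "B0 k \<noteq> {}" "k \<ge> 1 \<Longrightarrow> B0 k = B k"
  using finite_B[of k] zero_B[of k] by (auto simp: B0_def)

lemma B_ne: "k \<ge> 1 \<Longrightarrow> B k \<noteq> {}"
  using zero_B by blast

sublocale prod: product_prob_space "\<lambda>k. uniform_count_measure (B0 k)" UNIV
  by (intro product_prob_spaceI prob_space_uniform_count_measure B0)

sublocale Om: prob_space Om
  unfolding Om_def by (rule prod.prob_space_axioms)

lemma space_Om: "\<omega> \<in> space Om \<longleftrightarrow> (\<forall>k. \<omega> k \<in> B0 k)"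
  by (simp add: Om_def space_PiM space_uniform_count_measure PiE_iff)

lemma space_Om_D: "\<omega> \<in> space Om \<Longrightarrow> k \<ge> 1 \<Longrightarrow> \<omega> k \<in> B k"
  using B0(3) space_Om by auto

lemma trunc_in_digs: "\<omega> \<in> space Om \<Longrightarrow> J \<subseteq> {1..} \<Longrightarrow> trunc J \<omega> \<in> digs B J"
  using space_Om_D by (auto simp: trunc_def digs_def)

lemma finite_digs_B: "finite J \<Longrightarrow> J \<subseteq> {1..} \<Longrightarrow> finite (digs B J)"
  by (rule finite_digs) (use finite_B in \<open>auto simp: subset_eq\<close>)

lemma card_digs_B_pos: "finite J \<Longrightarrow> J \<subseteq> {1..} \<Longrightarrow> card (digs B J) > 0"
  unfolding card_digs using finite_B B_ne by (auto simp: card_gt_0_iff intro!: prod_pos)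

lemma cylinder:
  assumes J: "finite J" "J \<subseteq> {1..}" and b: "b \<in> digs B J"
  defines "Z \<equiv> {\<omega>\<in>space Om. trunc J \<omega> = b}"
  shows "Z \<in> sets Om" "measure Om Z = 1 / card (digs B J)"
proof -
  have bB: "b k \<in> B k" if "k \<in> J" for k using b that by (auto simp: digs_def)
  have "Z = prod_emb UNIV (\<lambda>k. uniform_count_measure (B0 k)) J (Pi\<^sub>E J (\<lambda>k. {b k}))"
  proof (rule set_eqI)
    fix \<omega>
    have "trunc J \<omega> = b \<longleftrightarrow> (\<forall>k\<in>J. \<omega> k = b k)"
      using b by (auto simp: trunc_def digs_def fun_eq_iff)
    then show "\<omega> \<in> Z \<longleftrightarrow> \<omega> \<in> prod_emb UNIV (\<lambda>k. uniform_count_measure (B0 k)) J (Pi\<^sub>E J (\<lambda>k. {b k}))"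
      unfolding Z_def by (auto simp: prod_emb_iff space_Om space_uniform_count_measure PiE_iff)
  qed
  moreover have X: "{b k} \<in> sets (uniform_count_measure (B0 k))" if "k \<in> J" for k
    using bB[OF that] J(2) that B0(3)[of k] by (auto simp: sets_uniform_count_measure)
  ultimately show "Z \<in> sets Om" 
    unfolding Om_def using J by (auto intro!: measurable_prod_emb sets_PiM_I_finite)
  have "measure Om Z = (\<Prod>k\<in>J. measure (uniform_count_measure (B0 k)) {b k})"
    unfolding \<open>Z = _\<close> Om_def by (rule prod.measure_PiM_emb) (use J X in auto)
  also have "\<dots> = (\<Prod>k\<in>J. 1 / card (B k))"
  proof (rule prod.cong)
    fix k assume "k \<in> J"
    then show "measure (uniform_count_measure (B0 k)) {b k} = 1 / card (B k)"
      using bB[of k] J(2) B0[of k] by (subst measure_uniform_count_measure) auto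
  qed simp
  finally show "measure Om Z = 1 / card (digs B J)"
    by (simp add: card_digs J prod_dividef)
qed

text \<open>A function of finitely many digits is a finite combination of cylinder indicators;
  measurability and expectation are read off from this form.\<close>

lemma expand_trunc:
  fixes h :: "(nat \<Rightarrow> int^'n) \<Rightarrow> 'b::real_vector"
  assumes "finite J" "J \<subseteq> {1..}" "\<omega> \<in> space Om"
  shows "h (trunc J \<omega>) = (\<Sum>b\<in>digs B J. indicator {\<omega>\<in>space Om. trunc J \<omega> = b} \<omega> *\<^sub>R h b)"
proof -
  have "(\<Sum>b\<in>digs B J. indicator {\<omega>\<in>space Om. trunc J \<omega> = b} \<omega> *\<^sub>R h b) =
      (\<Sum>b\<in>{trunc J \<omega>}. indicator {\<omega>\<in>space Om. trunc J \<omega> = b} \<omega> *\<^sub>R h b)"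
    by (rule sum.mono_neutral_right)
      (use assms finite_digs_B trunc_in_digs in \<open>auto simp: indicator_def\<close>)
  then show ?thesis using assms by simp
qed

lemma measurable_trunc:
  fixes h :: "(nat \<Rightarrow> int^'n) \<Rightarrow> 'b::{real_normed_vector, second_countable_topology}"
  assumes J: "finite J" "J \<subseteq> {1..}"
  shows "(\<lambda>\<omega>. h (trunc J \<omega>)) \<in> borel_measurable Om"
proof -
  have "(\<lambda>\<omega>. \<Sum>b\<in>digs B J. indicator {\<omega>\<in>space Om. trunc J \<omega> = b} \<omega> *\<^sub>R h b) \<in> borel_measurable Om"
    by (intro borel_measurable_sum borel_measurable_scaleR borel_measurable_indicator
        borel_measurable_const cylinder(1) J)
  then show ?thesis
    by (subst measurable_cong[OF expand_trunc[OF J]])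
qed

lemma expectation_trunc:
  fixes h :: "(nat \<Rightarrow> int^'n) \<Rightarrow> 'b::{banach, second_countable_topology}"
  assumes J: "finite J" "J \<subseteq> {1..}"
  shows "(\<integral>\<omega>. h (trunc J \<omega>) \<partial>Om) = (\<Sum>b\<in>digs B J. h b) /\<^sub>R card (digs B J)"
proof -
  have "(\<integral>\<omega>. h (trunc J \<omega>) \<partial>Om) =
      (\<integral>\<omega>. (\<Sum>b\<in>digs B J. indicator {\<omega>\<in>space Om. trunc J \<omega> = b} \<omega> *\<^sub>R h b) \<partial>Om)"
    by (intro Bochner_Integration.integral_cong refl expand_trunc J)
  also have "\<dots> = (\<Sum>b\<in>digs B J. measure Om {\<omega>\<in>space Om. trunc J \<omega> = b} *\<^sub>R h b)"
    by (subst Bochner_Integration.integral_sum)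
      (auto simp: cylinder(1)[OF J] less_top[symmetric] intro!: sum.cong)
  also have "\<dots> = (\<Sum>b\<in>digs B J. h b) /\<^sub>R card (digs B J)"
    by (simp add: cylinder(2)[OF J] scaleR_sum_right inverse_eq_divide)
  finally show ?thesis .
qed

definition X :: "(nat \<Rightarrow> int^'n) \<Rightarrow> real^'n" where
  "X \<omega> = (\<Sum>k. scaled R (Suc k) (\<omega> (Suc k)))"

definition tail :: "nat \<Rightarrow> (nat \<Rightarrow> int^'n) \<Rightarrow> real^'n" where
  "tail n \<omega> = X \<omega> - psum R {1..n} \<omega>"

lemma psum_tendsto_X:
  assumes "\<omega> \<in> space Om"
  shows "(\<lambda>n. psum R {1..n} \<omega>) \<longlonglongrightarrow> X \<omega>"
proof -
  have "summable (\<lambda>k. scaled R (Suc k) (\<omega> (Suc k)))"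
    using series_converge space_Om_D[OF assms] unfolding series_converge_def by blast
  then have "(\<lambda>n. \<Sum>k<n. scaled R (Suc k) (\<omega> (Suc k))) \<longlonglongrightarrow> X \<omega>"
    unfolding X_def by (rule summable_LIMSEQ)
  moreover have "(\<Sum>k<n. scaled R (Suc k) (\<omega> (Suc k))) = psum R {1..n} \<omega>" for n
    unfolding psum_def by (rule sum.reindex_bij_witness[of _ "\<lambda>k. k - 1" Suc]) auto
  ultimately show ?thesis by simp
qed

lemma psum_split: "psum R {1..n + m} \<omega> = psum R {1..n} \<omega> + psum R {n<..n+m} \<omega>"
proof -
  have "{1..n + m} = {1..n} \<union> {n<..n+m}" "{1..n} \<inter> {n<..n+m} = {}" by auto
  then show ?thesis unfolding psum_def by (simp only: sum.union_disjoint finite_atLeastAtMost finite_greaterThanAtMost)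
qed

lemma psum_tendsto_tail:
  assumes "\<omega> \<in> space Om"
  shows "(\<lambda>m. psum R {n<..n+m} \<omega>) \<longlonglongrightarrow> tail n \<omega>"
proof -
  have "(\<lambda>m. psum R {1..n+m} \<omega>) \<longlonglongrightarrow> X \<omega>"
    using LIMSEQ_ignore_initial_segment[OF psum_tendsto_X[OF assms], of n] by (simp only: add.commute)
  then have "(\<lambda>m. psum R {1..n+m} \<omega> - psum R {1..n} \<omega>) \<longlonglongrightarrow> tail n \<omega>"
    unfolding tail_def by (intro tendsto_diff tendsto_const)
  then show ?thesis by (simp only: psum_split add_diff_cancel_left')
qed

lemma tail_tendsto_0:
  assumes "\<omega> \<in> space Om"
  shows "(\<lambda>n. tail n \<omega>) \<longlonglongrightarrow> 0"
  unfolding tail_def using tendsto_diff[OF tendsto_const psum_tendsto_X[OF assms], of "X \<omega>"] by simp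

lemma measurable_psum:
  assumes "finite J" "J \<subseteq> {1..}"
  shows "psum R J \<in> borel_measurable Om"
  using measurable_trunc[OF assms, of "psum R J"] by simp

lemma measurable_psum_atLeast [measurable]: "psum R {1..n} \<in> borel_measurable Om"
  by (rule measurable_psum) auto

lemma measurable_psum_greaterThan [measurable]: "psum R {n<..m} \<in> borel_measurable Om"
  by (rule measurable_psum) auto

lemma measurable_X [measurable]: "X \<in> borel_measurable Om"
  by (rule borel_measurable_LIMSEQ_metric[OF measurable_psum_atLeast psum_tendsto_X])

lemma measurable_tail [measurable]: "tail n \<in> borel_measurable Om"
  unfolding tail_def by measurable

lemma X_eq: "X \<omega> = psum R {1..n} \<omega> + tail n \<omega>"
  by (simp add: tail_def)

lemma tail_0: "tail 0 = X"
  by (simp add: tail_def psum_def fun_eq_iff)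

text \<open>The convolution of the factors \<open>n + 1, ..., n + m\<close> and the partial sum
  \<open>psum R {n<..n+m}\<close> give the same integrals. The partial sums converge pointwise to
  \<open>tail n\<close>, so dominated convergence yields the weak limit. Together with uniqueness
  this identifies \<open>mu_gt R B n\<close> with the law of \<open>tail n\<close>, and \<mu> with
  the law of \<open>X\<close>.\<close>

lemma is_inf_conv_tail: "is_inf_conv R B n (distr Om borel (tail n))"
  unfolding is_inf_conv_def weak_limit_def
proof (intro conjI allI impI)
  show "prob_space (distr Om borel (tail n))" by (rule Om.prob_space_distr) simp
  fix f :: "real^'n \<Rightarrow> real" assume "continuous_on UNIV f \<and> bounded (range f)"
  then have f: "continuous_on UNIV f" "bounded (range f)" by auto
  then obtain c where c: "\<And>x. \<bar>f x\<bar> \<le> c" by (auto simp: bounded_iff)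
  have [measurable]: "f \<in> borel_measurable borel"
    by (rule borel_measurable_continuous_onI[OF f(1)])
  have "(\<integral>x. f x \<partial>fin_conv R B n m) = (\<integral>\<omega>. f (psum R {n<..n+m} \<omega>) \<partial>Om)" for m
    using expectation_trunc[of "{n<..n+m}" "\<lambda>b. f (psum R {n<..n+m} b)"]
    by (simp add: integral_fin_conv[OF inv finite_B B_ne _ c] subset_eq divide_inverse mult.commute)
  moreover have "(\<lambda>m. \<integral>\<omega>. f (psum R {n<..n+m} \<omega>) \<partial>Om) \<longlonglongrightarrow> (\<integral>\<omega>. f (tail n \<omega>) \<partial>Om)"
  proof (rule integral_dominated_convergence[where w="\<lambda>_. c"])
    show "AE \<omega> in Om. (\<lambda>m. f (psum R {n<..n+m} \<omega>)) \<longlonglongrightarrow> f (tail n \<omega>)"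
      using f(1) by (intro AE_I2 continuous_on_tendsto_compose[OF f(1) psum_tendsto_tail]) auto
  qed (use c in auto)
  ultimately show "(\<lambda>m. \<integral>x. f x \<partial>fin_conv R B n m) \<longlonglongrightarrow> (\<integral>x. f x \<partial>distr Om borel (tail n))"
    by (simp add: integral_distr)
qed simp

text \<open>Independence of the first \<open>n\<close> digits and the tail. For a finite piece of
  the tail it is the factorisation of a finite sum by \<open>sum_digs_split\<close>; continuity and
  boundedness of \<open>g\<close> carry it to the full tail as \<open>m\<close> tends to
  infinity.\<close>

lemma expectation_trunc_tail:
  fixes w :: "(nat \<Rightarrow> int^'n) \<Rightarrow> complex" and g :: "real^'n \<Rightarrow> complex"
  assumes g: "continuous_on UNIV g" "\<And>x. cmod (g x) \<le> 1"
  shows "(\<integral>\<omega>. w (trunc {1..n} \<omega>) * g (tail n \<omega>) \<partial>Om) =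
    (\<integral>\<omega>. w (trunc {1..n} \<omega>) \<partial>Om) * (\<integral>\<omega>. g (tail n \<omega>) \<partial>Om)"
proof -
  have [measurable]: "g \<in> borel_measurable borel"
    by (rule borel_measurable_continuous_onI[OF g(1)])
  have [measurable]: "(\<lambda>\<omega>. w (trunc {1..n} \<omega>)) \<in> borel_measurable Om"
    by (rule measurable_trunc) auto
  define c where "c = (\<Sum>b\<in>digs B {1..n}. cmod (w b))"
  have c: "cmod (w (trunc {1..n} \<omega>)) \<le> c" if "\<omega> \<in> space Om" for \<omega>
    unfolding c_def by (rule member_le_sum[of _ _ "\<lambda>b. cmod (w b)"]) (use that in \<open>auto intro!: trunc_in_digs finite_digs_B\<close>)
  have split: "(\<integral>\<omega>. w (trunc {1..n} \<omega>) * g (psum R {n<..n+m} \<omega>) \<partial>Om) =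
    (\<integral>\<omega>. w (trunc {1..n} \<omega>) \<partial>Om) * (\<integral>\<omega>. g (psum R {n<..n+m} \<omega>) \<partial>Om)" for m
  proof -
    let ?K = "{1..n}" and ?J = "{n<..n+m}"
    let ?g = "\<lambda>b. g (psum R ?J b)"
    have disj: "?J \<inter> ?K = {}" and sub: "?J \<subseteq> {1..}" "?K \<subseteq> {1..}" "?J \<union> ?K \<subseteq> {1..}"
      and fin: "finite ?J" "finite ?K" "finite (?J \<union> ?K)" by auto
    have tr: "trunc ?K (trunc (?J \<union> ?K) \<omega>) = trunc ?K \<omega>" "trunc ?J (trunc (?J \<union> ?K) \<omega>) = trunc ?J \<omega>" for \<omega> :: "nat \<Rightarrow> int^'n"
      by (auto simp: trunc_def fun_eq_iff)
    have "(\<integral>\<omega>. w (trunc ?K \<omega>) * ?g \<omega> \<partial>Om) =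
        (\<integral>\<omega>. (\<lambda>b. w (trunc ?K b) * ?g (trunc ?J b)) (trunc (?J \<union> ?K) \<omega>) \<partial>Om)"
      by (simp only: tr psum_trunc)
    also have "\<dots> = (\<Sum>b\<in>digs B (?J \<union> ?K). w (trunc ?K b) * ?g (trunc ?J b)) /\<^sub>R card (digs B (?J \<union> ?K))"
      by (rule expectation_trunc[OF fin(3) sub(3)])
    also have "\<dots> = ((\<Sum>b\<in>digs B ?K. w b) * (\<Sum>b\<in>digs B ?J. ?g b)) /\<^sub>R (card (digs B ?J) * card (digs B ?K))"
      unfolding sum_digs_split[OF fin(1) disj, of w ?g] card_digs[OF fin(1)] card_digs[OF fin(2)]
        card_digs[OF fin(3)] prod.union_disjoint[OF fin(1,2) disj] ..
    also have "\<dots> = (\<integral>\<omega>. w (trunc ?K \<omega>) \<partial>Om) * (\<integral>\<omega>. ?g (trunc ?J \<omega>) \<partial>Om)"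
      unfolding expectation_trunc[OF fin(1) sub(1), of ?g] expectation_trunc[OF fin(2) sub(2)]
      by (simp add: mult.commute)
    finally show ?thesis by simp
  qed
  have "(\<lambda>m. \<integral>\<omega>. w (trunc {1..n} \<omega>) * g (psum R {n<..n+m} \<omega>) \<partial>Om) \<longlonglongrightarrow>
      (\<integral>\<omega>. w (trunc {1..n} \<omega>) * g (tail n \<omega>) \<partial>Om)"
  proof (rule integral_dominated_convergence[where w="\<lambda>_. c"])
    show "(\<lambda>\<omega>. w (trunc {1..n} \<omega>) * g (tail n \<omega>)) \<in> borel_measurable Om"
      by measurable
    show "(\<lambda>\<omega>. w (trunc {1..n} \<omega>) * g (psum R {n<..n+m} \<omega>)) \<in> borel_measurable Om" for m
      by measurable
    show "AE \<omega> in Om. (\<lambda>m. w (trunc {1..n} \<omega>) * g (psum R {n<..n+m} \<omega>)) \<longlonglongrightarrow> w (trunc {1..n} \<omega>) * g (tail n \<omega>)"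
      by (intro AE_I2 tendsto_mult tendsto_const continuous_on_tendsto_compose[OF g(1) psum_tendsto_tail]) auto
    show "AE \<omega> in Om. norm (w (trunc {1..n} \<omega>) * g (psum R {n<..n+m} \<omega>)) \<le> c" for m
    proof (intro AE_I2)
      fix \<omega> assume "\<omega> \<in> space Om"
      then show "norm (w (trunc {1..n} \<omega>) * g (psum R {n<..n+m} \<omega>)) \<le> c"
        using c[of \<omega>] g(2)[of "psum R {n<..n+m} \<omega>"] mult_mono[of "cmod (w (trunc {1..n} \<omega>))" c "cmod (g (psum R {n<..n+m} \<omega>))" 1]
        by (simp add: norm_mult order_trans[OF norm_ge_zero])
    qed
  qed auto
  moreover have "(\<lambda>m. \<integral>\<omega>. g (psum R {n<..n+m} \<omega>) \<partial>Om) \<longlonglongrightarrow> (\<integral>\<omega>. g (tail n \<omega>) \<partial>Om)"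
  proof (rule integral_dominated_convergence[where w="\<lambda>_. 1"])
    show "AE \<omega> in Om. (\<lambda>m. g (psum R {n<..n+m} \<omega>)) \<longlonglongrightarrow> g (tail n \<omega>)"
      by (intro AE_I2 continuous_on_tendsto_compose[OF g(1) psum_tendsto_tail]) auto
  qed (use g(2) in auto)
  then have "(\<lambda>m. (\<integral>\<omega>. w (trunc {1..n} \<omega>) \<partial>Om) * (\<integral>\<omega>. g (psum R {n<..n+m} \<omega>) \<partial>Om)) \<longlonglongrightarrow>
      (\<integral>\<omega>. w (trunc {1..n} \<omega>) \<partial>Om) * (\<integral>\<omega>. g (tail n \<omega>) \<partial>Om)"
    by (rule tendsto_mult[OF tendsto_const])
  ultimately show ?thesis
    unfolding split by (rule LIMSEQ_unique)
qed

end

section \<open>Passing to the limit\<close>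

text \<open>The mixed term is split with weights by
  \<open>0 \<le> (t * cmod a - cmod b)\<^sup>2 / t\<close>. For small \<open>t\<close> the main term
  keeps almost its exact constant, at the price of a large factor on the error.\<close>

lemma cmod_add_sq_young:
  assumes "t > 0"
  shows "(cmod (a + b))\<^sup>2 \<le> (1 + t) * (cmod a)\<^sup>2 + (1 + 1 / t) * (cmod b)\<^sup>2"
proof -
  have "(cmod (a + b))\<^sup>2 \<le> (cmod a + cmod b)\<^sup>2"
    by (intro power_mono norm_triangle_ineq) auto
  also have "\<dots> \<le> (1 + t) * (cmod a)\<^sup>2 + (1 + 1 / t) * (cmod b)\<^sup>2"
  proof -
    have "0 \<le> (t * cmod a - cmod b)\<^sup>2 / t" using assms by simp
    also have "\<dots> = (1 + t) * (cmod a)\<^sup>2 + (1 + 1 / t) * (cmod b)\<^sup>2 - (cmod a + cmod b)\<^sup>2"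
      using assms by (simp add: field_simps power2_eq_square)
    finally show ?thesis by simp
  qed
  finally show ?thesis .
qed

text \<open>The order of the limits matters: \<open>K t\<close> may blow up as \<open>t\<close>
  tends to 0, so \<epsilon> goes to 0 first with \<open>t\<close> fixed.\<close>

lemma young_limit:
  fixes a b :: real
  assumes "\<And>t \<epsilon>. t > 0 \<Longrightarrow> \<epsilon> > 0 \<Longrightarrow> a \<le> (1 + t)\<^sup>2 * b + K t * \<epsilon>"
  shows "a \<le> b"
proof -
  have t: "a \<le> (1 + t)\<^sup>2 * b" if "t > 0" for t
  proof (rule tendsto_lowerbound[where F="at_right 0" and f="\<lambda>\<epsilon>. (1 + t)\<^sup>2 * b + K t * \<epsilon>"])
    show "((\<lambda>\<epsilon>. (1 + t)\<^sup>2 * b + K t * \<epsilon>) \<longlongrightarrow> (1 + t)\<^sup>2 * b) (at_right 0)"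
      by (auto intro!: tendsto_eq_intros)
    show "\<forall>\<^sub>F \<epsilon> in at_right 0. a \<le> (1 + t)\<^sup>2 * b + K t * \<epsilon>"
      using assms[OF that] by (auto simp: eventually_at_filter)
  qed simp
  show ?thesis
  proof (rule tendsto_lowerbound[where F="at_right 0" and f="\<lambda>t. (1 + t)\<^sup>2 * b"])
    show "((\<lambda>t. (1 + t)\<^sup>2 * b) \<longlongrightarrow> b) (at_right 0)"
      by (auto intro!: tendsto_eq_intros)
    show "\<forall>\<^sub>F t in at_right 0. a \<le> (1 + t)\<^sup>2 * b"
      using t by (auto simp: eventually_at_filter)
  qed simp
qed

section \<open>Stability of frame inequalities under mean square approximation\<close>

definition inner_L2 :: "'a measure \<Rightarrow> ('a \<Rightarrow> complex) \<Rightarrow> ('a \<Rightarrow> complex) \<Rightarrow> complex" where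
  "inner_L2 M f g = (\<integral>x. f x * cnj (g x) \<partial>M)"

definition norm2_L2 :: "'a measure \<Rightarrow> ('a \<Rightarrow> complex) \<Rightarrow> real" where
  "norm2_L2 M f = (\<integral>x. (cmod (f x))\<^sup>2 \<partial>M)"

lemma norm2_L2_nonneg [simp]: "0 \<le> norm2_L2 M f"
  by (simp add: norm2_L2_def)

lemma norm2_L2_young:
  assumes "t > 0" "in_L2 M f" "in_L2 M g"
  shows "norm2_L2 M (\<lambda>x. f x + g x) \<le> (1 + t) * norm2_L2 M f + (1 + 1 / t) * norm2_L2 M g"
proof -
  note i = in_L2_integrable[OF assms(2)] in_L2_integrable[OF assms(3)] in_L2_integrable[OF in_L2_add[OF assms(2,3)]]
  have "norm2_L2 M (\<lambda>x. f x + g x) \<le> (\<integral>x. (1 + t) * (cmod (f x))\<^sup>2 + (1 + 1 / t) * (cmod (g x))\<^sup>2 \<partial>M)"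
    unfolding norm2_L2_def by (intro integral_mono cmod_add_sq_young assms(1)) (use i in auto)
  then show ?thesis using i by (simp add: norm2_L2_def)
qed

lemma norm2_L2_minus_commute: "norm2_L2 M (\<lambda>x. f x - g x) = norm2_L2 M (\<lambda>x. g x - f x)"
  by (simp add: norm2_L2_def norm_minus_commute)

lemma borel_measurable_cnj [measurable (raw)]:
  "f \<in> borel_measurable M \<Longrightarrow> (\<lambda>x. cnj (f x)) \<in> borel_measurable M"
  by (rule borel_measurable_continuous_on[where f=cnj]) (intro continuous_intros)

lemma (in finite_measure) inner_L2_integrable:
  assumes "in_L2 M f" "e \<in> borel_measurable M" "\<And>x. cmod (e x) \<le> 1"
  shows "integrable M (\<lambda>x. f x * cnj (e x))"
  by (intro in_L2_imp_integrable in_L2_mult_bounded assms) (use assms in auto)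

lemma (in finite_measure) inner_L2_add:
  assumes "in_L2 M f" "in_L2 M g" "e \<in> borel_measurable M" "\<And>x. cmod (e x) \<le> 1"
  shows "inner_L2 M (\<lambda>x. f x + g x) e = inner_L2 M f e + inner_L2 M g e"
  using assms by (simp add: inner_L2_def ring_distribs inner_L2_integrable)

lemma (in prob_space) cmod_inner_L2_sq_le:
  assumes "in_L2 M f" "e \<in> borel_measurable M" "\<And>x. cmod (e x) \<le> 1"
  shows "(cmod (inner_L2 M f e))\<^sup>2 \<le> norm2_L2 M f"
proof -
  have L: "in_L2 M (\<lambda>x. f x * cnj (e x))"
    by (intro in_L2_mult_bounded assms) (use assms in auto)
  have "(cmod (inner_L2 M f e))\<^sup>2 \<le> (\<integral>x. (cmod (f x * cnj (e x)))\<^sup>2 \<partial>M)"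
    unfolding inner_L2_def by (rule cmod_expectation_sq_le[OF L])
  also have "\<dots> \<le> norm2_L2 M f"
    unfolding norm2_L2_def
    by (rule integral_mono[OF in_L2_integrable[OF L] in_L2_integrable[OF assms(1)]])
      (use assms(3) in \<open>auto intro!: power_mono simp: norm_mult mult_left_le\<close>)
  finally show ?thesis .
qed

lemma (in prob_space) sum_inner_L2_young:
  assumes "t > 0" "in_L2 M f" "in_L2 M g"
    and "\<And>i. e i \<in> borel_measurable M" "\<And>i x. cmod (e i x) \<le> 1"
  shows "(\<Sum>i\<in>F. (cmod (inner_L2 M (\<lambda>x. f x + g x) (e i)))\<^sup>2) \<le>
    (1 + t) * (\<Sum>i\<in>F. (cmod (inner_L2 M f (e i)))\<^sup>2) + (1 + 1 / t) * (\<Sum>i\<in>F. (cmod (inner_L2 M g (e i)))\<^sup>2)"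
  unfolding sum_distrib_left sum.distrib[symmetric]
  by (intro sum_mono) (simp add: inner_L2_add assms cmod_add_sq_young)

text \<open>For a fixed finite \<open>F\<close> the coefficients of \<open>f - H\<close> can be
  bounded one at a time by the norm. This costs a factor \<open>card F\<close>, which goes into the
  error constant and disappears in the limit.\<close>

lemma (in prob_space) Bessel_closure:
  assumes e: "\<And>i. e i \<in> borel_measurable M" "\<And>i x. cmod (e i x) \<le> 1"
    and S: "\<And>H. H \<in> S \<Longrightarrow> in_L2 M H" and D: "0 \<le> D"
    and bessel: "\<And>H. H \<in> S \<Longrightarrow> (\<Sum>i\<in>F. (cmod (inner_L2 M H (e i)))\<^sup>2) \<le> D * norm2_L2 M H"
    and f: "in_L2 M f" and approx: "\<And>\<epsilon>. \<epsilon> > 0 \<Longrightarrow> \<exists>H\<in>S. norm2_L2 M (\<lambda>x. f x - H x) < \<epsilon>"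
  shows "(\<Sum>i\<in>F. (cmod (inner_L2 M f (e i)))\<^sup>2) \<le> D * norm2_L2 M f"
proof (rule young_limit)
  fix t \<epsilon> :: real assume t: "t > 0" and "\<epsilon> > 0"
  then obtain H where H: "H \<in> S" "norm2_L2 M (\<lambda>x. f x - H x) < \<epsilon>" using approx by blast
  let ?T = "\<lambda>g. \<Sum>i\<in>F. (cmod (inner_L2 M g (e i)))\<^sup>2"
  have L: "in_L2 M H" "in_L2 M (\<lambda>x. f x - H x)" "in_L2 M (\<lambda>x. H x - f x)"
    using S H f by (auto intro: in_L2_diff)
  have "?T (\<lambda>x. f x - H x) \<le> card F * \<epsilon>"
  proof -
    have "?T (\<lambda>x. f x - H x) \<le> (\<Sum>i\<in>F. \<epsilon>)"
      by (intro sum_mono order_trans[OF cmod_inner_L2_sq_le]) (use H(2) L e in auto)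
    then show ?thesis by simp
  qed
  have "?T f = ?T (\<lambda>x. H x + (f x - H x))" by simp
  also have "\<dots> \<le> (1 + t) * ?T H + (1 + 1 / t) * ?T (\<lambda>x. f x - H x)"
    by (rule sum_inner_L2_young[OF t L(1,2) e])
  also have "\<dots> \<le> (1 + t) * (D * norm2_L2 M H) + (1 + 1 / t) * (card F * \<epsilon>)"
    using t by (intro add_mono mult_left_mono bessel H \<open>?T (\<lambda>x. f x - H x) \<le> card F * \<epsilon>\<close>) auto
  also have "norm2_L2 M H = norm2_L2 M (\<lambda>x. f x + (H x - f x))" by simp
  also have "(1 + t) * (D * \<dots>) \<le> (1 + t) * (D * ((1 + t) * norm2_L2 M f + (1 + 1 / t) * \<epsilon>))"
  proof (intro mult_left_mono)
    have "(1 + 1 / t) * norm2_L2 M (\<lambda>x. H x - f x) \<le> (1 + 1 / t) * \<epsilon>"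
      using t H(2) by (intro mult_left_mono) (auto simp: norm2_L2_minus_commute[of M H])
    then show "norm2_L2 M (\<lambda>x. f x + (H x - f x)) \<le> (1 + t) * norm2_L2 M f + (1 + 1 / t) * \<epsilon>"
      using norm2_L2_young[OF t f L(3)] by linarith
  qed (use t D in auto)
  \<comment> \<open>One factor \<open>1 + t\<close> comes from replacing \<open>f\<close> by
    \<open>H\<close> in the coefficients, the other from returning from \<open>H\<close> to
    \<open>f\<close> in the norm.\<close>
  finally show "?T f \<le> (1 + t)\<^sup>2 * (D * norm2_L2 M f) + ((1 + t) * D * (1 + 1 / t) + (1 + 1 / t) * card F) * \<epsilon>"
    by (simp only: power2_eq_square algebra_simps)
qed

lemma summable_on_if_sums_le:
  fixes p :: "'i \<Rightarrow> real"
  assumes "\<And>i. i \<in> I \<Longrightarrow> 0 \<le> p i" "\<And>F. finite F \<Longrightarrow> F \<subseteq> I \<Longrightarrow> sum p F \<le> c"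
  shows "p summable_on I"
  by (rule nonneg_bdd_above_summable_on) (use assms in \<open>auto simp: bdd_above_def\<close>)

text \<open>The sum is infinite, so the error in the coefficients must be bounded uniformly over the
  finite subsets of \<open>I\<close>, and a factor \<open>card F\<close> is not affordable. The
  Bessel bound for \<open>H - f\<close> gives this uniformity; the closure of \<open>S\<close> under
  differences is what makes that bound accessible.\<close>

lemma (in prob_space) frame_lower_closure:
  assumes e: "\<And>i. e i \<in> borel_measurable M" "\<And>i x. cmod (e i x) \<le> 1"
    and S: "\<And>H. H \<in> S \<Longrightarrow> in_L2 M H" and CD: "0 \<le> C" "0 \<le> D"
    and S_diff: "\<And>H K. H \<in> S \<Longrightarrow> K \<in> S \<Longrightarrow> (\<lambda>x. H x - K x) \<in> S"
    and bessel: "\<And>H F. H \<in> S \<Longrightarrow> finite F \<Longrightarrow> F \<subseteq> I \<Longrightarrow>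
      (\<Sum>i\<in>F. (cmod (inner_L2 M H (e i)))\<^sup>2) \<le> D * norm2_L2 M H"
    and lower: "\<And>H. H \<in> S \<Longrightarrow> C * norm2_L2 M H \<le> (\<Sum>\<^sub>\<infinity>i\<in>I. (cmod (inner_L2 M H (e i)))\<^sup>2)"
    and f: "in_L2 M f" and approx: "\<And>\<epsilon>. \<epsilon> > 0 \<Longrightarrow> \<exists>H\<in>S. norm2_L2 M (\<lambda>x. f x - H x) < \<epsilon>"
  shows "C * norm2_L2 M f \<le> (\<Sum>\<^sub>\<infinity>i\<in>I. (cmod (inner_L2 M f (e i)))\<^sup>2)"
proof (rule young_limit)
  fix t \<epsilon> :: real assume t: "t > 0" and "\<epsilon> > 0"
  then obtain H where H: "H \<in> S" "norm2_L2 M (\<lambda>x. f x - H x) < \<epsilon>" using approx by blast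
  let ?T = "\<lambda>F g. \<Sum>i\<in>F. (cmod (inner_L2 M g (e i)))\<^sup>2"
  let ?T' = "\<lambda>g. \<Sum>\<^sub>\<infinity>i\<in>I. (cmod (inner_L2 M g (e i)))\<^sup>2"
  have L: "in_L2 M H" "in_L2 M (\<lambda>x. f x - H x)" "in_L2 M (\<lambda>x. H x - f x)"
    using S H f by (auto intro: in_L2_diff)
  have bessel_f: "?T F f \<le> D * norm2_L2 M f" if "finite F" "F \<subseteq> I" for F
    by (rule Bessel_closure[where S=S]) (use e S CD bessel that f approx in auto)
  have bessel_d: "?T F (\<lambda>x. H x - f x) \<le> D * \<epsilon>" if F: "finite F" "F \<subseteq> I" for F
  proof -
    have "?T F (\<lambda>x. H x - f x) \<le> D * norm2_L2 M (\<lambda>x. H x - f x)"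
    proof (rule Bessel_closure[where S=S])
      fix \<delta> :: real assume "\<delta> > 0"
      then obtain K where K: "K \<in> S" "norm2_L2 M (\<lambda>x. f x - K x) < \<delta>" using approx by blast
      \<comment> \<open>If \<open>K\<close> approximates \<open>f\<close>, then \<open>H - K\<close>
        approximates \<open>H - f\<close> with the same error and stays in \<open>S\<close>.\<close>
      have "norm2_L2 M (\<lambda>x. H x - f x - (H x - K x)) < \<delta>"
        using K(2) by (simp add: norm2_L2_minus_commute[of M f K])
      then show "\<exists>K\<in>S. norm2_L2 M (\<lambda>x. H x - f x - K x) < \<delta>"
        using S_diff[OF H(1) K(1)] by (intro bexI[of _ "\<lambda>x. H x - K x"])
    qed (use e S CD bessel F L in auto)
    also have "\<dots> \<le> D * \<epsilon>"
      using H(2) CD by (intro mult_left_mono) (auto simp: norm2_L2_minus_commute[of M H])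
    finally show ?thesis .
  qed
  have sum_f: "(\<lambda>i. (cmod (inner_L2 M f (e i)))\<^sup>2) summable_on I"
    by (rule summable_on_if_sums_le[OF _ bessel_f]) auto
  have sum_H: "(\<lambda>i. (cmod (inner_L2 M H (e i)))\<^sup>2) summable_on I"
    by (rule summable_on_if_sums_le[OF _ bessel[OF H(1)]]) auto
  have "?T' H \<le> (1 + t) * ?T' f + (1 + 1 / t) * (D * \<epsilon>)"
  proof (rule infsum_le_finite_sums[OF sum_H])
    fix F assume F: "finite F" "F \<subseteq> I"
    have "?T F H = ?T F (\<lambda>x. f x + (H x - f x))" by simp
    also have "\<dots> \<le> (1 + t) * ?T F f + (1 + 1 / t) * ?T F (\<lambda>x. H x - f x)"
      by (rule sum_inner_L2_young[OF t f L(3) e])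
    also have "\<dots> \<le> (1 + t) * ?T' f + (1 + 1 / t) * (D * \<epsilon>)"
      using t by (intro add_mono mult_left_mono bessel_d F finite_sum_le_infsum sum_f) auto
    finally show "?T F H \<le> (1 + t) * ?T' f + (1 + 1 / t) * (D * \<epsilon>)" .
  qed
  then have "C * norm2_L2 M H \<le> (1 + t) * ?T' f + (1 + 1 / t) * (D * \<epsilon>)"
    using lower[OF H(1)] by linarith
  then have *: "(1 + t) * (C * norm2_L2 M H) \<le> (1 + t) * ((1 + t) * ?T' f + (1 + 1 / t) * (D * \<epsilon>))"
    using t by (intro mult_left_mono) auto
  have "norm2_L2 M f = norm2_L2 M (\<lambda>x. H x + (f x - H x))" by simp
  also have "\<dots> \<le> (1 + t) * norm2_L2 M H + (1 + 1 / t) * norm2_L2 M (\<lambda>x. f x - H x)"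
    by (rule norm2_L2_young[OF t L(1,2)])
  also have "\<dots> \<le> (1 + t) * norm2_L2 M H + (1 + 1 / t) * \<epsilon>"
    using t H(2) by (intro add_mono mult_left_mono) auto
  finally have "C * norm2_L2 M f \<le> C * ((1 + t) * norm2_L2 M H + (1 + 1 / t) * \<epsilon>)"
    by (rule mult_left_mono[OF _ CD(1)])
  then show "C * norm2_L2 M f \<le> (1 + t)\<^sup>2 * ?T' f + ((1 + t) * (1 + 1 / t) * D + C * (1 + 1 / t)) * \<epsilon>"
    using * by (simp only: power2_eq_square algebra_simps)
qed

text \<open>Dominated convergence for sums over an exhaustion \<open>G n\<close> of \<open>I\<close>.\<close>

lemma exhaustion_limit_le_infsum:
  fixes p :: "'i \<Rightarrow> real" and q :: "nat \<Rightarrow> 'i \<Rightarrow> real"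
  assumes p: "p summable_on I" "\<And>i. i \<in> I \<Longrightarrow> 0 \<le> p i" and \<delta>: "\<delta> > 0"
    and G: "\<And>n. finite (G n)" "\<And>n. G n \<subseteq> I"
      "\<And>F. finite F \<Longrightarrow> F \<subseteq> I \<Longrightarrow> \<forall>\<^sub>F n in sequentially. F \<subseteq> G n"
    and q: "\<And>n i. n \<ge> 1 \<Longrightarrow> i \<in> G n \<Longrightarrow> q n i \<le> p i / \<delta>" "\<And>i. i \<in> I \<Longrightarrow> (\<lambda>n. q n i) \<longlonglongrightarrow> p i"
    and c: "\<And>n. c n \<le> sum (q n) (G n)" "c \<longlonglongrightarrow> c'"
  shows "c' \<le> infsum p I"
proof (rule field_le_epsilon)
  fix \<epsilon> :: real assume "\<epsilon> > 0"
  \<comment> \<open>Outside such an \<open>F\<close> the terms of \<open>p\<close> sum to less than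
    \<open>\<delta> * \<epsilon>\<close>. The domination of \<open>q n\<close> by
    \<open>p / \<delta>\<close> turns this into an error of at most \<epsilon> for all
    \<open>q n\<close> at once, and only the finite set \<open>F\<close> is left for the termwise
    limit.\<close>
  have "\<exists>F. finite F \<and> F \<subseteq> I \<and> infsum p I - \<delta> * \<epsilon> < sum p F"
  proof (rule ccontr)
    assume "\<not> ?thesis"
    then have "infsum p I \<le> infsum p I - \<delta> * \<epsilon>"
      by (intro infsum_le_finite_sums[OF p(1)]) (auto simp: not_less)
    then show False using \<delta> \<open>\<epsilon> > 0\<close> by (auto simp: mult_le_0_iff)
  qed
  then obtain F where F: "finite F" "F \<subseteq> I" "infsum p I - \<delta> * \<epsilon> < sum p F" by blast
  have ev: "\<forall>\<^sub>F n in sequentially. c n \<le> sum (q n) F + \<epsilon>"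
    using G(3)[OF F(1,2)] eventually_ge_at_top[of 1]
  proof eventually_elim
    case (elim n)
    have "sum (q n) (G n) = sum (q n) F + sum (q n) (G n - F)"
      using elim G(1) by (metis add.commute sum.subset_diff)
    moreover have "sum (q n) (G n - F) \<le> sum p (G n - F) / \<delta>"
      unfolding sum_divide_distrib by (intro sum_mono q) (use elim in auto)
    moreover have "sum p F + sum p (G n - F) \<le> infsum p I"
    proof -
      have "sum p F + sum p (G n - F) = sum p (G n)"
        using elim G(1) by (metis add.commute sum.subset_diff)
      also have "\<dots> \<le> infsum p I"
        by (intro finite_sum_le_infsum p G) (use p in auto)
      finally show ?thesis .
    qed
    then have "sum p (G n - F) / \<delta> \<le> \<epsilon>"
      using F(3) \<delta> by (simp add: divide_le_eq mult.commute)
    ultimately show ?case using c(1)[of n] by linarith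
  qed
  have "c' \<le> sum p F + \<epsilon>"
    by (rule tendsto_le[OF _ _ c(2) ev])
      (use q(2) F(2) in \<open>auto intro!: tendsto_intros\<close>)
  also have "sum p F \<le> infsum p I"
    by (intro finite_sum_le_infsum p F) (use p in auto)
  finally show "c' \<le> infsum p I + \<epsilon>" by simp
qed

section \<open>Exponentials on the digit space\<close>

lemma digs_subset_digit_seqs:
  assumes "\<And>k. k \<ge> 1 \<Longrightarrow> 0 \<in> L k"
  shows "digs L {1..n} \<subseteq> digit_seqs L"
proof
  fix l assume l: "l \<in> digs L {1..n}"
  have "finite {k. l k \<noteq> 0}"
    by (rule finite_subset[of _ "{1..n}"]) (use l in \<open>auto simp: digs_def\<close>)
  moreover have "l k \<in> L k" if "k \<ge> 1" for k
    using l assms[OF that] that by (cases "k \<in> {1..n}") (auto simp: digs_def)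
  ultimately show "l \<in> digit_seqs L"
    using l by (auto simp: digit_seqs_def digs_def)
qed

lemma digit_seqs_eventually_digs:
  assumes zero: "\<And>k. k \<ge> 1 \<Longrightarrow> 0 \<in> L k" and F: "finite F" "F \<subseteq> digit_seqs L"
  shows "\<forall>\<^sub>F n in sequentially. F \<subseteq> digs L {1..n}"
proof -
  have "\<forall>\<^sub>F n in sequentially. l \<in> digs L {1..n}" if "l \<in> F" for l
  proof -
    have l: "l \<in> digit_seqs L" using F that by auto
    then obtain n where n: "\<And>k. l k \<noteq> 0 \<Longrightarrow> k \<le> n"
      by (auto simp: digit_seqs_def finite_nat_set_iff_bounded_le)
    have "l \<in> digs L {1..m}" if "m \<ge> n" for m
    proof -
      have "l k = 0" if "k \<notin> {1..m}" for k
      proof (rule ccontr)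
        assume "l k \<noteq> 0"
        then have "k \<le> m" "k \<noteq> 0" using n[of k] \<open>m \<ge> n\<close> l by (auto simp: digit_seqs_def intro: ccontr)
        then show False using that by auto
      qed
      then show ?thesis using l by (auto simp: digs_def digit_seqs_def)
    qed
    then show ?thesis by (rule eventually_sequentiallyI)
  qed
  then have "\<forall>\<^sub>F n in sequentially. \<forall>l\<in>F. l \<in> digs L {1..n}"
    using F(1) by (simp add: eventually_ball_finite)
  then show ?thesis by (auto simp: subset_eq)
qed

lemma freq_digs_in_Lambda_n:
  assumes "l \<in> digs L {1..n}"
  shows "freq R l \<in> Lambda_n R L n"
proof -
  have "freq R l = (\<Sum>k=1..n. prodRT R (k - 1) *v l k)"
    by (rule freq_eq) (use assms in \<open>auto simp: digs_def\<close>)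
  then show ?thesis using assms by (auto simp: Lambda_n_def digs_def)
qed

lemma tower_bounds_LIMSEQ:
  assumes "tower_bounds C D"
  shows "(\<lambda>n. \<Prod>k=1..n. C k) \<longlonglongrightarrow> (\<Prod>j. C (Suc j))" "(\<lambda>n. \<Prod>k=1..n. D k) \<longlonglongrightarrow> (\<Prod>j. D (Suc j))"
    "0 < (\<Prod>j. C (Suc j))" "(\<Prod>j. C (Suc j)) \<le> (\<Prod>j. D (Suc j))"
proof -
  have *: "(\<lambda>n. \<Prod>k=1..n. E k) \<longlonglongrightarrow> (\<Prod>j. E (Suc j))" if "convergent_prod (\<lambda>j. E (Suc j))" for E :: "nat \<Rightarrow> real"
  proof -
    \<comment> \<open>The product over \<open>i \<le> n\<close> has \<open>Suc n\<close> factors;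
      the resulting shift of the sequence is undone at the end.\<close>
    have "(\<Prod>i\<le>n. E (Suc i)) = (\<Prod>k=1..Suc n. E k)" for n
      by (rule prod.reindex_bij_witness[of _ "\<lambda>k. k - 1" Suc]) auto
    then have "(\<lambda>n. \<Prod>k=1..Suc n. E k) \<longlonglongrightarrow> (\<Prod>j. E (Suc j))"
      using convergent_prod_LIMSEQ[OF that] by simp
    then show ?thesis by (rule LIMSEQ_imp_Suc)
  qed
  show C: "(\<lambda>n. \<Prod>k=1..n. C k) \<longlonglongrightarrow> (\<Prod>j. C (Suc j))" and D: "(\<lambda>n. \<Prod>k=1..n. D k) \<longlonglongrightarrow> (\<Prod>j. D (Suc j))"
    using assms unfolding tower_bounds_def by (intro *; blast)+
  show "0 < (\<Prod>j. C (Suc j))" using assms by (simp add: tower_bounds_def)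
  have "(\<Prod>k=1..n. C k) \<le> (\<Prod>k=1..n. D k)" for n
    by (intro prod_mono) (use assms in \<open>auto simp: tower_bounds_def intro: less_imp_le\<close>)
  then show "(\<Prod>j. C (Suc j)) \<le> (\<Prod>j. D (Suc j))"
    by (intro LIMSEQ_le[OF C D]) auto
qed

section \<open>Coefficients of functions of finitely many digits, and their density\<close>

context digit_convolution
begin

definition char_X :: "(nat \<Rightarrow> int^'n) \<Rightarrow> (nat \<Rightarrow> int^'n) \<Rightarrow> complex" where
  "char_X l \<omega> = cis2pi (real_vec (freq R l) \<bullet> X \<omega>)"

definition tail_coeff :: "nat \<Rightarrow> (nat \<Rightarrow> int^'n) \<Rightarrow> complex" where
  "tail_coeff n l = (\<integral>\<omega>. cis2pi (- (real_vec (freq R l) \<bullet> tail n \<omega>)) \<partial>Om)"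

lemma measurable_cis2pi [measurable (raw)]: "f \<in> borel_measurable M \<Longrightarrow> (\<lambda>x. cis2pi (f x)) \<in> borel_measurable M"
  by (rule borel_measurable_continuous_on[where f=cis2pi]) (intro continuous_intros)

lemma measurable_char_X [measurable]: "char_X l \<in> borel_measurable Om"
  unfolding char_X_def by measurable

lemma cmod_char_X [simp]: "cmod (char_X l \<omega>) = 1"
  by (simp add: char_X_def)

lemma fourier_mu_gt: "fourier (mu_gt R B n) (real_vec (freq R l)) = tail_coeff n l"
proof -
  have e: "(\<lambda>x. cis (- 2 * pi * (y \<bullet> x))) = (\<lambda>x. cis2pi (- (y \<bullet> x)))" for y :: "real^'n"
    by (simp add: cis2pi_def fun_eq_iff)
  have "fourier (distr Om borel (tail n)) (real_vec (freq R l)) = tail_coeff n l"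
    unfolding fourier_def tail_coeff_def e by (subst integral_distr) auto
  then show ?thesis by (simp add: mu_gt_eq[OF is_inf_conv_tail])
qed

lemma cmod_tail_coeff_le: "cmod (tail_coeff n l) \<le> 1"
proof -
  have "cmod (tail_coeff n l) \<le> (\<integral>\<omega>. cmod (cis2pi (- (real_vec (freq R l) \<bullet> tail n \<omega>))) \<partial>Om)"
    unfolding tail_coeff_def by (rule integral_norm_bound)
  then show ?thesis by (simp add: Om.prob_space)
qed

lemma tail_coeff_tendsto: "(\<lambda>n. tail_coeff n l) \<longlonglongrightarrow> 1"
proof -
  have "(\<lambda>n. tail_coeff n l) \<longlonglongrightarrow> (\<integral>\<omega>. 1 \<partial>Om)"
    unfolding tail_coeff_def
  proof (rule integral_dominated_convergence[where w="\<lambda>_. 1"])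
    show "AE \<omega> in Om. (\<lambda>n. cis2pi (- (real_vec (freq R l) \<bullet> tail n \<omega>))) \<longlonglongrightarrow> 1"
    proof (intro AE_I2)
      fix \<omega> assume "\<omega> \<in> space Om"
      have "continuous_on UNIV (\<lambda>x. cis2pi (- (real_vec (freq R l) \<bullet> x)))"
        by (intro continuous_intros)
      from continuous_on_tendsto_compose[OF this tail_tendsto_0[OF \<open>\<omega> \<in> space Om\<close>]]
      show "(\<lambda>n. cis2pi (- (real_vec (freq R l) \<bullet> tail n \<omega>))) \<longlonglongrightarrow> 1" by simp
    qed
  qed auto
  then show ?thesis by (simp add: Om.prob_space)
qed

lemma phase_trunc [simp]: "phase R n (trunc {1..n} \<omega>) l = phase R n \<omega> l"
  by (simp add: phase_def psum_trunc[of R "{1..n}", unfolded One_nat_def])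

definition level_coeff :: "nat \<Rightarrow> ((nat \<Rightarrow> int^'n) \<Rightarrow> complex) \<Rightarrow> (nat \<Rightarrow> int^'n) \<Rightarrow> complex" where
  "level_coeff n w l = (\<integral>\<omega>. w (trunc {1..n} \<omega>) * cnj (phase R n \<omega> l) \<partial>Om)"

text \<open>The tail is independent of the first \<open>n\<close> digits.\<close>

lemma inner_char_X:
  "inner_L2 Om (\<lambda>\<omega>. w (trunc {1..n} \<omega>)) (char_X l) = level_coeff n w l * tail_coeff n l"
proof -
  let ?g = "\<lambda>x. cis2pi (- (real_vec (freq R l) \<bullet> x))"
  have "cnj (char_X l \<omega>) = cnj (phase R n (trunc {1..n} \<omega>) l) * ?g (tail n \<omega>)" for \<omega>
    by (simp only: char_X_def X_eq[of \<omega> n] inner_add_right phase_trunc)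
      (simp add: cis2pi_add cnj_cis2pi phase_def inner_commute)
  then have "inner_L2 Om (\<lambda>\<omega>. w (trunc {1..n} \<omega>)) (char_X l) =
      (\<integral>\<omega>. (\<lambda>b. w b * cnj (phase R n b l)) (trunc {1..n} \<omega>) * ?g (tail n \<omega>) \<partial>Om)"
    unfolding inner_L2_def by (simp only: mult.assoc)
  also have "\<dots> = (\<integral>\<omega>. (\<lambda>b. w b * cnj (phase R n b l)) (trunc {1..n} \<omega>) \<partial>Om) * (\<integral>\<omega>. ?g (tail n \<omega>) \<partial>Om)"
    by (rule expectation_trunc_tail) (auto intro!: continuous_intros)
  also have "\<dots> = level_coeff n w l * tail_coeff n l"
    by (simp only: level_coeff_def tail_coeff_def phase_trunc)
  finally show ?thesis .
qed

lemma level_coeff_eq: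
  "level_coeff n w l = (\<Sum>b\<in>digs B {1..n}. w b * cnj (phase R n b l)) /\<^sub>R card (digs B {1..n})"
proof -
  have "level_coeff n w l = (\<integral>\<omega>. (\<lambda>b. w b * cnj (phase R n b l)) (trunc {1..n} \<omega>) \<partial>Om)"
    by (simp only: level_coeff_def phase_trunc)
  also have "\<dots> = (\<Sum>b\<in>digs B {1..n}. w b * cnj (phase R n b l)) /\<^sub>R card (digs B {1..n})"
    by (rule expectation_trunc) auto
  finally show ?thesis .
qed

lemma norm2_step:
  "norm2_L2 Om (\<lambda>\<omega>. w (trunc {1..n} \<omega>)) = (\<Sum>b\<in>digs B {1..n}. (cmod (w b))\<^sup>2) / card (digs B {1..n})"
  using expectation_trunc[of "{1..n}" "\<lambda>b. (cmod (w b))\<^sup>2"] by (auto simp: norm2_L2_def divide_inverse mult.commute)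

lemma step_level_mono:
  assumes "n \<ge> N"
  shows "w (trunc {1..N} \<omega>) = (\<lambda>b. w (trunc {1..N} b)) (trunc {1..n} \<omega>)"
proof -
  have "trunc {1..N} (trunc {1..n} \<omega>) = trunc {1..N} \<omega>"
    using assms by (auto simp: trunc_def fun_eq_iff)
  then show ?thesis by simp
qed

text \<open>The test functions of the two closure lemmas. They are functions of the digit sequence
  and are not asked to factor through \<open>X\<close>.\<close>

definition steps :: "((nat \<Rightarrow> int^'n) \<Rightarrow> complex) set" where
  "steps = {\<lambda>\<omega>. w (trunc {1..N} \<omega>) | w N. True}"

lemma stepsI: "(\<lambda>\<omega>. w (trunc {1..N} \<omega>)) \<in> steps"
  unfolding steps_def by blast

text \<open>A single \<open>w\<close> serves at every level \<open>n \<ge> N\<close>, because it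
  reads only digits up to \<open>N\<close>. This allows the level to tend to infinity while
  \<open>H\<close> stays fixed.\<close>

lemma stepsE:
  assumes "H \<in> steps"
  obtains w N where "\<And>n. n \<ge> N \<Longrightarrow> H = (\<lambda>\<omega>. w (trunc {1..n} \<omega>))"
proof -
  obtain w N where H: "H = (\<lambda>\<omega>. w (trunc {1..N} \<omega>))" using assms by (auto simp: steps_def)
  have "H = (\<lambda>\<omega>. (\<lambda>b. w (trunc {1..N} b)) (trunc {1..n} \<omega>))" if "n \<ge> N" for n
    unfolding H by (rule ext, rule step_level_mono[OF that])
  then show ?thesis by (rule that)
qed

lemma steps_in_L2: 
  assumes "H \<in> steps"
  shows "in_L2 Om H"
proof -
  obtain w N where H: "H = (\<lambda>\<omega>. w (trunc {1..N} \<omega>))" using assms by (auto simp: steps_def)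
  show ?thesis
    unfolding H
  proof (rule Om.in_L2_bounded)
    show "(\<lambda>\<omega>. w (trunc {1..N} \<omega>)) \<in> borel_measurable Om" by (rule measurable_trunc) auto
    show "cmod (w (trunc {1..N} \<omega>)) \<le> (\<Sum>b\<in>digs B {1..N}. cmod (w b))" if "\<omega> \<in> space Om" for \<omega>
      by (rule member_le_sum[of _ _ "\<lambda>b. cmod (w b)"]) (use that in \<open>auto intro!: trunc_in_digs finite_digs_B\<close>)
  qed
qed

lemma steps_diff:
  assumes "H \<in> steps" "K \<in> steps"
  shows "(\<lambda>\<omega>. H \<omega> - K \<omega>) \<in> steps"
proof -
  obtain w N where H: "\<And>n. n \<ge> N \<Longrightarrow> H = (\<lambda>\<omega>. w (trunc {1..n} \<omega>))" using stepsE[OF assms(1)] by blast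
  obtain v M where K: "\<And>n. n \<ge> M \<Longrightarrow> K = (\<lambda>\<omega>. v (trunc {1..n} \<omega>))" using stepsE[OF assms(2)] by blast
  show ?thesis
    unfolding H[of "max N M", OF max.cobounded1] K[of "max N M", OF max.cobounded2]
    by (rule stepsI[where w = "\<lambda>b. w b - v b"])
qed

lemma in_L2_comp_X:
  assumes "in_L2 (distr Om borel X) f"
  shows "in_L2 Om (\<lambda>\<omega>. f (X \<omega>))"
proof -
  have [measurable]: "f \<in> borel_measurable borel" using assms by (simp add: in_L2_def)
  have "integrable (distr Om borel X) (\<lambda>x. (cmod (f x))\<^sup>2)" using assms by (simp add: in_L2_def)
  then have "integrable Om (\<lambda>\<omega>. (cmod (f (X \<omega>)))\<^sup>2)"
    by (subst (asm) integrable_distr_eq) auto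
  then show ?thesis by (simp add: in_L2_def)
qed

lemma steps_dense:
  assumes f: "in_L2 (distr Om borel X) f" and "\<epsilon> > 0"
  shows "\<exists>H\<in>steps. norm2_L2 Om (\<lambda>\<omega>. f (X \<omega>) - H \<omega>) < \<epsilon>"
proof -
  interpret D: prob_space "distr Om borel X" by (rule Om.prob_space_distr) simp
  have "cont_approx (distr Om borel X) f"
    by (rule in_L2_imp_cont_approx[OF _ _ f]) (auto intro: D.finite_measure)
  then obtain g where g: "continuous_on UNIV g" "bounded (range g)"
      "(\<integral>x. (cmod (f x - g x))\<^sup>2 \<partial>distr Om borel X) < \<epsilon> / 4"
    using \<open>\<epsilon> > 0\<close> unfolding cont_approx_def by (meson divide_pos_pos zero_less_numeral)
  obtain c where c: "\<And>x. cmod (g x) \<le> c" using g(2) by (auto simp: bounded_iff)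
  have [measurable]: "f \<in> borel_measurable borel" using f by (simp add: in_L2_def)
  have [measurable]: "g \<in> borel_measurable borel"
    by (rule borel_measurable_continuous_onI[OF g(1)])
  have fg: "norm2_L2 Om (\<lambda>\<omega>. f (X \<omega>) - g (X \<omega>)) < \<epsilon> / 4"
    using g(3) by (simp add: integral_distr norm2_L2_def)
  define H where "H n = (\<lambda>\<omega>. g (psum R {1..n} \<omega>))" for n
  have H: "H n \<in> steps" for n
    using stepsI[of "\<lambda>b. g (psum R {1..n} b)" n] by (simp only: H_def psum_trunc)
  have "(\<lambda>n. norm2_L2 Om (\<lambda>\<omega>. g (X \<omega>) - H n \<omega>)) \<longlonglongrightarrow> (\<integral>\<omega>. 0 \<partial>Om)"
    unfolding norm2_L2_def H_def
  proof (rule integral_dominated_convergence[where w="\<lambda>_. (2 * c)\<^sup>2"])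
    show "(\<lambda>\<omega>. (cmod (g (X \<omega>) - g (psum R {1..n} \<omega>)))\<^sup>2) \<in> borel_measurable Om" for n
      by measurable
    show "AE \<omega> in Om. (\<lambda>n. (cmod (g (X \<omega>) - g (psum R {1..n} \<omega>)))\<^sup>2) \<longlonglongrightarrow> 0"
    proof (intro AE_I2)
      fix \<omega> assume "\<omega> \<in> space Om"
      have "(\<lambda>n. (cmod (g (X \<omega>) - g (psum R {1..n} \<omega>)))\<^sup>2) \<longlonglongrightarrow> (cmod (g (X \<omega>) - g (X \<omega>)))\<^sup>2"
        by (intro tendsto_intros continuous_on_tendsto_compose[OF g(1) psum_tendsto_X[OF \<open>\<omega> \<in> space Om\<close>]]) auto
      then show "(\<lambda>n. (cmod (g (X \<omega>) - g (psum R {1..n} \<omega>)))\<^sup>2) \<longlonglongrightarrow> 0" by simp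
    qed
    show "AE \<omega> in Om. norm ((cmod (g (X \<omega>) - g (psum R {1..n} \<omega>)))\<^sup>2) \<le> (2 * c)\<^sup>2" for n
    proof (intro AE_I2)
      fix \<omega>
      have "cmod (g (X \<omega>) - g (psum R {1..n} \<omega>)) \<le> 2 * c"
        using norm_triangle_ineq4[of "g (X \<omega>)" "g (psum R {1..n} \<omega>)"] c[of "X \<omega>"] c[of "psum R {1..n} \<omega>"] by linarith
      then show "norm ((cmod (g (X \<omega>) - g (psum R {1..n} \<omega>)))\<^sup>2) \<le> (2 * c)\<^sup>2"
        by (simp only: real_norm_def abs_power2 power_mono norm_ge_zero)
    qed
  qed simp_all
  then have "(\<lambda>n. norm2_L2 Om (\<lambda>\<omega>. g (X \<omega>) - H n \<omega>)) \<longlonglongrightarrow> 0" by simp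
  then have "\<forall>\<^sub>F n in sequentially. norm2_L2 Om (\<lambda>\<omega>. g (X \<omega>) - H n \<omega>) < \<epsilon> / 4"
    by (rule order_tendstoD) (use \<open>\<epsilon> > 0\<close> in simp)
  then obtain n where n: "norm2_L2 Om (\<lambda>\<omega>. g (X \<omega>) - H n \<omega>) < \<epsilon> / 4"
    using eventually_sequentially by auto
  have gL: "in_L2 Om (\<lambda>\<omega>. g (X \<omega>))" by (rule Om.in_L2_bounded[where c=c]) (use c in auto)
  have "norm2_L2 Om (\<lambda>\<omega>. f (X \<omega>) - g (X \<omega>) + (g (X \<omega>) - H n \<omega>)) < \<epsilon>"
    using integral_cmod_add_sq_le[OF in_L2_diff[OF in_L2_comp_X[OF f] gL] in_L2_diff[OF gL steps_in_L2[OF H[of n]]]] fg n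
    unfolding norm2_L2_def by linarith
  then show ?thesis using H[of n] by (intro bexI[of _ "H n"]) auto
qed

lemma inner_norm_distr:
  assumes "f \<in> borel_measurable borel"
  shows "(\<integral>x. f x * cnj (expo (freq R l) x) \<partial>distr Om borel X) = inner_L2 Om (\<lambda>\<omega>. f (X \<omega>)) (char_X l)"
    and "(\<integral>x. (cmod (f x))\<^sup>2 \<partial>distr Om borel X) = norm2_L2 Om (\<lambda>\<omega>. f (X \<omega>))"
proof -
  have [measurable]: "f \<in> borel_measurable borel" by fact
  have e: "expo (freq R l) = (\<lambda>x. cis2pi (real_vec (freq R l) \<bullet> x))" by (simp add: expo_def cis2pi_def fun_eq_iff)
  show "(\<integral>x. f x * cnj (expo (freq R l) x) \<partial>distr Om borel X) = inner_L2 Om (\<lambda>\<omega>. f (X \<omega>)) (char_X l)"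
    unfolding e inner_L2_def char_X_def by (subst integral_distr) auto
  show "(\<integral>x. (cmod (f x))\<^sup>2 \<partial>distr Om borel X) = norm2_L2 Om (\<lambda>\<omega>. f (X \<omega>))"
    unfolding norm2_L2_def by (subst integral_distr) auto
qed

end

section \<open>Frame and Riesz bounds for the exponentials\<close>

context digit_convolution
begin

text \<open>This is \<open>frame_tower_level\<close> divided by the square of the number
  \<open>m\<close> of digit blocks: a squared coefficient carries two factors \<open>1 / m\<close>,
  the squared norm carries one, and the factor \<open>m\<close> of the unnormalised estimate cancels
  the difference.\<close>

lemma frame_level:
  assumes tower: "frame_tower R B L C D"
  shows "(\<Prod>k=1..n. C k) * norm2_L2 Om (\<lambda>\<omega>. w (trunc {1..n} \<omega>)) \<le> (\<Sum>l\<in>digs L {1..n}. (cmod (level_coeff n w l))\<^sup>2)"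
    and "(\<Sum>l\<in>digs L {1..n}. (cmod (level_coeff n w l))\<^sup>2) \<le> (\<Prod>k=1..n. D k) * norm2_L2 Om (\<lambda>\<omega>. w (trunc {1..n} \<omega>))"
proof -
  define m where "m = real (card (digs B {1..n}))"
  have m: "m > 0" using card_digs_B_pos[of "{1..n}"] by (auto simp: m_def)
  have CD: "0 \<le> C j \<and> 0 \<le> D j" if "j \<ge> 1" for j
    using tower that unfolding frame_tower_def tower_bounds_def by (meson less_le_trans less_imp_le)
  have tr: "frame_triple (R j) (B j) (L j) (C j) (D j)" if "j \<ge> 1" for j
    using tower that unfolding frame_tower_def by blast
  let ?T = "\<Sum>l\<in>digs L {1..n}. (cmod (\<Sum>b\<in>digs B {1..n}. w b * cnj (phase R n b l)))\<^sup>2"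
  let ?S = "\<Sum>b\<in>digs B {1..n}. (cmod (w b))\<^sup>2"
  have lvl: "(\<Prod>k=1..n. C k) * m * ?S \<le> ?T" "?T \<le> (\<Prod>k=1..n. D k) * m * ?S"
    using frame_tower_level[of R B C D L n w, OF inv finite_B B_ne _ _ tr] CD unfolding m_def by auto
  have T: "(\<Sum>l\<in>digs L {1..n}. (cmod (level_coeff n w l))\<^sup>2) = ?T / m\<^sup>2"
    unfolding level_coeff_eq m_def by (simp add: power_mult_distrib divide_inverse sum_distrib_left power_inverse mult.commute)
  have S: "norm2_L2 Om (\<lambda>\<omega>. w (trunc {1..n} \<omega>)) = ?S / m"
    unfolding norm2_step m_def ..
  show "(\<Prod>k=1..n. C k) * norm2_L2 Om (\<lambda>\<omega>. w (trunc {1..n} \<omega>)) \<le> (\<Sum>l\<in>digs L {1..n}. (cmod (level_coeff n w l))\<^sup>2)"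
    unfolding T S using lvl(1) m by (simp add: pos_le_divide_eq power2_eq_square mult_ac)
  show "(\<Sum>l\<in>digs L {1..n}. (cmod (level_coeff n w l))\<^sup>2) \<le> (\<Prod>k=1..n. D k) * norm2_L2 Om (\<lambda>\<omega>. w (trunc {1..n} \<omega>))"
    unfolding T S using lvl(2) m by (simp add: pos_divide_le_eq power2_eq_square mult_ac)
qed

lemma steps_bessel:
  assumes tower: "frame_tower R B L C D" and L: "\<And>k. k \<ge> 1 \<Longrightarrow> finite (L k)" "\<And>k. k \<ge> 1 \<Longrightarrow> 0 \<in> L k"
    and H: "H \<in> steps" and F: "finite F" "F \<subseteq> digit_seqs L"
  shows "(\<Sum>l\<in>F. (cmod (inner_L2 Om H (char_X l)))\<^sup>2) \<le> (\<Prod>j. D (Suc j)) * norm2_L2 Om H"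
proof -
  obtain w N where w: "\<And>n. n \<ge> N \<Longrightarrow> H = (\<lambda>\<omega>. w (trunc {1..n} \<omega>))" using stepsE[OF H] by blast
  have D: "(\<lambda>n. \<Prod>k=1..n. D k) \<longlonglongrightarrow> (\<Prod>j. D (Suc j))"
    using tower tower_bounds_LIMSEQ unfolding frame_tower_def by blast
  have digs: "\<forall>\<^sub>F n in sequentially. F \<subseteq> digs L {1..n}"
    by (rule digit_seqs_eventually_digs[OF _ F]) (rule L)
  have ev: "\<forall>\<^sub>F n in sequentially. (\<Sum>l\<in>F. (cmod (inner_L2 Om H (char_X l)))\<^sup>2) \<le> (\<Prod>k=1..n. D k) * norm2_L2 Om H"
    using digs eventually_ge_at_top[of N]
  proof eventually_elim
    case (elim n)
    have "(\<Sum>l\<in>F. (cmod (inner_L2 Om H (char_X l)))\<^sup>2) \<le> (\<Sum>l\<in>F. (cmod (level_coeff n w l))\<^sup>2)"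
      unfolding w[OF elim(2)] inner_char_X norm_mult
      by (intro sum_mono power_mono mult_left_le cmod_tail_coeff_le) auto
    also have "\<dots> \<le> (\<Sum>l\<in>digs L {1..n}. (cmod (level_coeff n w l))\<^sup>2)"
      by (intro sum_mono2 finite_digs elim) (use L in auto)
    also have "\<dots> \<le> (\<Prod>k=1..n. D k) * norm2_L2 Om H"
      using frame_level(2)[OF tower, of n w] unfolding w[OF elim(2)] .
    finally show ?case .
  qed
  show ?thesis
    by (rule tendsto_lowerbound[OF tendsto_mult_right[OF D] ev]) simp
qed

lemma steps_frame_lower:
  assumes tower: "frame_tower R B L C D" and L: "\<And>k. k \<ge> 1 \<Longrightarrow> finite (L k)" "\<And>k. k \<ge> 1 \<Longrightarrow> 0 \<in> L k"
    and \<delta>: "\<delta> > 0" "\<And>n l. n \<ge> 1 \<Longrightarrow> l \<in> digs L {1..n} \<Longrightarrow> \<delta> \<le> (cmod (tail_coeff n l))\<^sup>2"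
    and H: "H \<in> steps"
  shows "(\<Prod>j. C (Suc j)) * norm2_L2 Om H \<le> (\<Sum>\<^sub>\<infinity>l\<in>digit_seqs L. (cmod (inner_L2 Om H (char_X l)))\<^sup>2)"
proof -
  obtain w N where w: "\<And>n. n \<ge> N \<Longrightarrow> H = (\<lambda>\<omega>. w (trunc {1..n} \<omega>))" using stepsE[OF H] by blast
  have C: "(\<lambda>n. \<Prod>k=1..n. C k) \<longlonglongrightarrow> (\<Prod>j. C (Suc j))"
    using tower tower_bounds_LIMSEQ unfolding frame_tower_def by blast
  define p where "p l = (cmod (inner_L2 Om H (char_X l)))\<^sup>2" for l
  \<comment> \<open>The shift by \<open>N\<close> makes the representation of \<open>H\<close> by
    \<open>w\<close> valid for every index \<open>n\<close>.\<close>
  define q where "q n l = (cmod (level_coeff (n + N) w l))\<^sup>2" for n l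
  have p: "p l = q n l * (cmod (tail_coeff (n + N) l))\<^sup>2" for n l
    unfolding p_def q_def w[of "n + N", OF le_add2] inner_char_X by (simp add: norm_mult power_mult_distrib)
  have "(\<Prod>j. C (Suc j)) * norm2_L2 Om H \<le> infsum p (digit_seqs L)"
  proof (rule exhaustion_limit_le_infsum[where G="\<lambda>n. digs L {1..n + N}" and q=q and \<delta>=\<delta>])
    show "p summable_on digit_seqs L"
      by (rule summable_on_if_sums_le[OF _ steps_bessel[OF tower L H, folded p_def]]) (auto simp: p_def)
    show "finite (digs L {1..n + N})" for n
      by (rule finite_digs) (use L in auto)
    show "digs L {1..n + N} \<subseteq> digit_seqs L" for n
      by (rule digs_subset_digit_seqs) (use L in auto)
    show digs: "\<forall>\<^sub>F n in sequentially. F \<subseteq> digs L {1..n + N}" if "finite F" "F \<subseteq> digit_seqs L" for F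
      by (rule sequentially_offset, rule digit_seqs_eventually_digs[OF _ that]) (rule L)
    show "q n l \<le> p l / \<delta>" if "n \<ge> 1" "l \<in> digs L {1..n + N}" for n l
    proof -
      have "q n l * \<delta> \<le> p l"
        unfolding p[of l n] by (intro mult_left_mono \<delta>(2)) (use that in \<open>auto simp: q_def\<close>)
      then show ?thesis using \<delta>(1) by (simp add: pos_le_divide_eq)
    qed
    show "(\<lambda>n. q n l) \<longlonglongrightarrow> p l" if "l \<in> digit_seqs L" for l
    proof -
      have "(\<lambda>n. (cmod (tail_coeff (n + N) l))\<^sup>2) \<longlonglongrightarrow> (cmod 1)\<^sup>2"
        by (intro tendsto_intros LIMSEQ_ignore_initial_segment tail_coeff_tendsto)
      then have "(\<lambda>n. p l / (cmod (tail_coeff (n + N) l))\<^sup>2) \<longlonglongrightarrow> p l / (cmod 1)\<^sup>2"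
        by (intro tendsto_divide tendsto_const) auto
      moreover have digs_l: "\<forall>\<^sub>F n in sequentially. {l} \<subseteq> digs L {1..n + N}"
        by (rule digs) (use that in auto)
      \<comment> \<open>Solving \<open>p\<close> for \<open>q n\<close> requires a nonzero tail
        coefficient. The bound \<delta> guarantees this once \<open>l\<close> fits into level
        \<open>n + N\<close>, hence only eventually.\<close>
      have "\<forall>\<^sub>F n in sequentially. p l / (cmod (tail_coeff (n + N) l))\<^sup>2 = q n l"
        using digs_l eventually_ge_at_top[of 1]
      proof eventually_elim
        case (elim n)
        have "\<delta> \<le> (cmod (tail_coeff (n + N) l))\<^sup>2"
          by (rule \<delta>(2)) (use elim in auto)
        then have "(cmod (tail_coeff (n + N) l))\<^sup>2 > 0"
          using \<delta>(1) by linarith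
        then show ?case unfolding p[of l n] by simp
      qed
      ultimately show ?thesis by (simp add: tendsto_cong)
    qed
    show "(\<Prod>k=1..n + N. C k) * norm2_L2 Om H \<le> sum (q n) (digs L {1..n + N})" for n
      using frame_level(1)[OF tower, of "n + N" w] unfolding q_def w[of "n + N", OF le_add2] .
    show "(\<lambda>n. (\<Prod>k=1..n + N. C k) * norm2_L2 Om H) \<longlonglongrightarrow> (\<Prod>j. C (Suc j)) * norm2_L2 Om H"
      by (intro tendsto_mult_right LIMSEQ_ignore_initial_segment[OF C])
  qed (use \<delta> in \<open>auto simp: p_def\<close>)
  then show ?thesis unfolding p_def .
qed

lemma in_L2_expo: "in_L2 (distr Om borel X) (expo l)"
proof -
  interpret D: prob_space "distr Om borel X" by (rule Om.prob_space_distr) simp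
  have e: "expo l = (\<lambda>x. cis2pi (real_vec l \<bullet> x))" by (simp add: expo_def cis2pi_def fun_eq_iff)
  show ?thesis unfolding e by (rule D.in_L2_bounded[where c=1]) auto
qed

lemma frame_exponentials:
  assumes tower: "frame_tower R B L C D" and L: "\<And>k. k \<ge> 1 \<Longrightarrow> finite (L k)" "\<And>k. k \<ge> 1 \<Longrightarrow> 0 \<in> L k"
    and \<delta>: "\<delta> > 0" "\<And>n l. n \<ge> 1 \<Longrightarrow> l \<in> digs L {1..n} \<Longrightarrow> \<delta> \<le> (cmod (tail_coeff n l))\<^sup>2"
  shows "L2_frame (distr Om borel X) (digit_seqs L) (\<lambda>l. expo (freq R l)) (\<Prod>j. C (Suc j)) (\<Prod>j. D (Suc j))"
  unfolding L2_frame_def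
proof (intro conjI allI impI ballI)
  have tb: "tower_bounds C D" using tower by (simp add: frame_tower_def)
  show C: "0 < (\<Prod>j. C (Suc j))" and CD: "(\<Prod>j. C (Suc j)) \<le> (\<Prod>j. D (Suc j))"
    using tower_bounds_LIMSEQ[OF tb] by auto
  show "in_L2 (distr Om borel X) (expo (freq R l))" for l by (rule in_L2_expo)
  fix f assume f: "in_L2 (distr Om borel X) f"
  then have fb: "f \<in> borel_measurable borel" by (simp add: in_L2_def)
  note eq = inner_norm_distr[OF fb]
  let ?f = "\<lambda>\<omega>. f (X \<omega>)"
  have fin: "(\<Sum>l\<in>F. (cmod (inner_L2 Om ?f (char_X l)))\<^sup>2) \<le> (\<Prod>j. D (Suc j)) * norm2_L2 Om ?f"
    if "finite F" "F \<subseteq> digit_seqs L" for F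
    by (rule Om.Bessel_closure[where S=steps])
      (use C CD f that steps_bessel[OF tower L] in \<open>auto intro: steps_in_L2 steps_dense in_L2_comp_X\<close>)
  show s: "(\<lambda>l. (cmod (\<integral>x. f x * cnj (expo (freq R l) x) \<partial>distr Om borel X))\<^sup>2) summable_on digit_seqs L"
    unfolding eq by (rule summable_on_if_sums_le[OF _ fin]) auto
  show "(\<Sum>\<^sub>\<infinity>l\<in>digit_seqs L. (cmod (\<integral>x. f x * cnj (expo (freq R l) x) \<partial>distr Om borel X))\<^sup>2)
      \<le> (\<Prod>j. D (Suc j)) * (\<integral>x. (cmod (f x))\<^sup>2 \<partial>distr Om borel X)"
    using s unfolding eq by (rule infsum_le_finite_sums[OF _ fin])
  show "(\<Prod>j. C (Suc j)) * (\<integral>x. (cmod (f x))\<^sup>2 \<partial>distr Om borel X) \<le>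
      (\<Sum>\<^sub>\<infinity>l\<in>digit_seqs L. (cmod (\<integral>x. f x * cnj (expo (freq R l) x) \<partial>distr Om borel X))\<^sup>2)"
    unfolding eq
    by (rule Om.frame_lower_closure[where S=steps and D="\<Prod>j. D (Suc j)"])
      (use C CD f steps_bessel[OF tower L] steps_frame_lower[OF tower L \<delta>] in
        \<open>auto intro: steps_in_L2 steps_diff steps_dense in_L2_comp_X\<close>)
qed

lemma riesz_level:
  assumes tower: "riesz_tower R B L C D" and L: "\<And>k. k \<ge> 1 \<Longrightarrow> finite (L k)"
    and F: "F \<subseteq> digs L {1..n}"
  shows "(\<Prod>k=1..n. C k) * (\<Sum>l\<in>F. (cmod (a l))\<^sup>2) \<le> norm2_L2 Om (\<lambda>\<omega>. \<Sum>l\<in>F. a l * phase R n \<omega> l)"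
    and "norm2_L2 Om (\<lambda>\<omega>. \<Sum>l\<in>F. a l * phase R n \<omega> l) \<le> (\<Prod>k=1..n. D k) * (\<Sum>l\<in>F. (cmod (a l))\<^sup>2)"
proof -
  define m where "m = real (card (digs B {1..n}))"
  \<comment> \<open>Extension by zero fits the finite set \<open>F\<close> into the full set of
    level \<open>n\<close> expansions, for which the tower estimate is stated.\<close>
  define a' where "a' l = (if l \<in> F then a l else 0)" for l
  have fin: "finite (digs L {1..n})" by (rule finite_digs) (use L in auto)
  have m: "m > 0" using card_digs_B_pos[of "{1..n}"] by (auto simp: m_def)
  have CD: "0 \<le> C j \<and> 0 \<le> D j" if "j \<ge> 1" for j
    using tower that unfolding riesz_tower_def tower_bounds_def by (meson less_le_trans less_imp_le)
  have tr: "riesz_triple (R j) (B j) (L j) (C j) (D j)" if "j \<ge> 1" for j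
    using tower that unfolding riesz_tower_def by blast
  let ?T = "\<Sum>b\<in>digs B {1..n}. (cmod (\<Sum>l\<in>F. a l * phase R n b l))\<^sup>2"
  let ?S = "\<Sum>l\<in>F. (cmod (a l))\<^sup>2"
  have S: "(\<Sum>l\<in>digs L {1..n}. (cmod (a' l))\<^sup>2) = ?S"
    by (rule sum.mono_neutral_cong_right[OF fin F]) (auto simp: a'_def)
  have "(\<Sum>l\<in>digs L {1..n}. a' l * phase R n b l) = (\<Sum>l\<in>F. a l * phase R n b l)" for b
    by (rule sum.mono_neutral_cong_right[OF fin F]) (auto simp: a'_def)
  then have lvl: "(\<Prod>k=1..n. C k) * m * ?S \<le> ?T" "?T \<le> (\<Prod>k=1..n. D k) * m * ?S"
    using riesz_tower_level[of R B C D L n a', OF inv finite_B B_ne _ _ tr] CD unfolding m_def S by auto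
  have "norm2_L2 Om (\<lambda>\<omega>. \<Sum>l\<in>F. a l * phase R n \<omega> l) = ?T / m"
    using norm2_step[of "\<lambda>b. \<Sum>l\<in>F. a l * phase R n b l" n] unfolding m_def by (simp only: phase_trunc)
  then show "(\<Prod>k=1..n. C k) * ?S \<le> norm2_L2 Om (\<lambda>\<omega>. \<Sum>l\<in>F. a l * phase R n \<omega> l)"
    and "norm2_L2 Om (\<lambda>\<omega>. \<Sum>l\<in>F. a l * phase R n \<omega> l) \<le> (\<Prod>k=1..n. D k) * ?S"
    using lvl m by (simp_all add: pos_le_divide_eq pos_divide_le_eq mult_ac)
qed

text \<open>A finite combination of exponentials is a bounded continuous function \<open>g\<close>,
  so its norm at \<open>X\<close> is the limit of its norms at the partial sums, where
  \<open>riesz_level\<close> applies as soon as \<open>F\<close> fits into the level. No density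
  argument enters.\<close>

lemma riesz_exponentials:
  assumes tower: "riesz_tower R B L C D" and L: "\<And>k. k \<ge> 1 \<Longrightarrow> finite (L k)" "\<And>k. k \<ge> 1 \<Longrightarrow> 0 \<in> L k"
    and F: "finite F" "F \<subseteq> digit_seqs L"
  shows "(\<Prod>j. C (Suc j)) * (\<Sum>l\<in>F. (cmod (a l))\<^sup>2) \<le>
      (\<integral>x. (cmod (\<Sum>l\<in>F. a l * expo (freq R l) x))\<^sup>2 \<partial>distr Om borel X)"
    and "(\<integral>x. (cmod (\<Sum>l\<in>F. a l * expo (freq R l) x))\<^sup>2 \<partial>distr Om borel X) \<le>
      (\<Prod>j. D (Suc j)) * (\<Sum>l\<in>F. (cmod (a l))\<^sup>2)"
proof -
  define g where "g x = (\<Sum>l\<in>F. a l * cis2pi (real_vec (freq R l) \<bullet> x))" for x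
  define c where "c = (\<Sum>l\<in>F. cmod (a l))"
  have g_cont: "continuous_on UNIV g" unfolding g_def by (intro continuous_intros)
  have [measurable]: "g \<in> borel_measurable borel" by (rule borel_measurable_continuous_onI[OF g_cont])
  have g_bd: "cmod (g x) \<le> c" for x
    unfolding g_def c_def by (rule order_trans[OF norm_sum]) (simp add: norm_mult)
  have "(\<Sum>l\<in>F. a l * expo (freq R l) x) = g x" for x by (simp add: g_def expo_def cis2pi_def)
  then have I: "(\<integral>x. (cmod (\<Sum>l\<in>F. a l * expo (freq R l) x))\<^sup>2 \<partial>distr Om borel X) = norm2_L2 Om (\<lambda>\<omega>. g (X \<omega>))"
    by (simp add: norm2_L2_def integral_distr)
  have "(\<lambda>n. norm2_L2 Om (\<lambda>\<omega>. g (psum R {1..n} \<omega>))) \<longlonglongrightarrow> norm2_L2 Om (\<lambda>\<omega>. g (X \<omega>))"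
    unfolding norm2_L2_def
  proof (rule integral_dominated_convergence[where w="\<lambda>_. c\<^sup>2"])
    show "(\<lambda>\<omega>. (cmod (g (psum R {1..n} \<omega>)))\<^sup>2) \<in> borel_measurable Om" for n
      by measurable
    show "AE \<omega> in Om. (\<lambda>n. (cmod (g (psum R {1..n} \<omega>)))\<^sup>2) \<longlonglongrightarrow> (cmod (g (X \<omega>)))\<^sup>2"
      by (intro AE_I2 tendsto_intros continuous_on_tendsto_compose[OF g_cont psum_tendsto_X]) auto
    show "AE \<omega> in Om. norm ((cmod (g (psum R {1..n} \<omega>)))\<^sup>2) \<le> c\<^sup>2" for n
      by (intro AE_I2) (simp only: real_norm_def abs_power2 power_mono norm_ge_zero g_bd)
  qed simp_all
  moreover have "g (psum R {1..n} \<omega>) = (\<Sum>l\<in>F. a l * phase R n \<omega> l)" for n \<omega>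
    by (simp add: g_def phase_def inner_commute)
  ultimately have lim: "(\<lambda>n. norm2_L2 Om (\<lambda>\<omega>. \<Sum>l\<in>F. a l * phase R n \<omega> l)) \<longlonglongrightarrow> norm2_L2 Om (\<lambda>\<omega>. g (X \<omega>))"
    by (simp only:)
  have tb: "tower_bounds C D" using tower by (simp add: riesz_tower_def)
  have ev: "\<forall>\<^sub>F n in sequentially. F \<subseteq> digs L {1..n}"
    by (rule digit_seqs_eventually_digs[OF _ F]) (rule L)
  show "(\<Prod>j. C (Suc j)) * (\<Sum>l\<in>F. (cmod (a l))\<^sup>2) \<le>
      (\<integral>x. (cmod (\<Sum>l\<in>F. a l * expo (freq R l) x))\<^sup>2 \<partial>distr Om borel X)"
    unfolding I
    by (rule tendsto_le[OF _ lim tendsto_mult_right[OF tower_bounds_LIMSEQ(1)[OF tb]]])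
      (use ev riesz_level(1)[OF tower L(1)] in \<open>auto elim!: eventually_mono\<close>)
  show "(\<integral>x. (cmod (\<Sum>l\<in>F. a l * expo (freq R l) x))\<^sup>2 \<partial>distr Om borel X) \<le>
      (\<Prod>j. D (Suc j)) * (\<Sum>l\<in>F. (cmod (a l))\<^sup>2)"
    unfolding I
    by (rule tendsto_le[OF _ tendsto_mult_right[OF tower_bounds_LIMSEQ(2)[OF tb]] lim])
      (use ev riesz_level(2)[OF tower L(1)] in \<open>auto elim!: eventually_mono\<close>)
qed

end

lemma delta_Lambda_le:
  assumes "\<And>k. k \<ge> 1 \<Longrightarrow> 0 \<in> L k" "n \<ge> 1" "l \<in> digs L {1..n}"
  shows "delta_Lambda R B L \<le> (cmod (fourier (mu_gt R B n) (real_vec (freq R l))))\<^sup>2"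
proof -
  let ?h = "\<lambda>n l. (cmod (fourier (mu_gt R B n) (real_vec l)))\<^sup>2"
  \<comment> \<open>The zero expansion gives an element. Nonemptiness is required to bound the inner
    infima below by 0, so that the outer infimum is a genuine lower bound.\<close>
  have ne: "Lambda_n R L m \<noteq> {}" for m
    using freq_digs_in_Lambda_n[of "\<lambda>_. 0" L m R] assms(1) by (auto simp: digs_def)
  have "delta_Lambda R B L \<le> (INF l\<in>Lambda_n R L n. ?h n l)"
    unfolding delta_Lambda_def
    by (rule cINF_lower) (use assms(2) ne in \<open>auto intro!: bdd_belowI2[where m=0] cINF_greatest\<close>)
  also have "\<dots> \<le> ?h n (freq R l)"
    by (rule cINF_lower) (use freq_digs_in_Lambda_n[OF assms(3)] in \<open>auto intro!: bdd_belowI2[where m=0]\<close>)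
  finally show ?thesis .
qed

theorem theorem3p3:
  fixes R :: "nat \<Rightarrow> int^'n^'n" and B L :: "nat \<Rightarrow> (int^'n) set"
    and C D :: "nat \<Rightarrow> real" and \<mu> :: "(real^'n) measure"
  assumes "\<And>j. j \<ge> 1 \<Longrightarrow> expanding (R j)"
    and "\<And>j. j \<ge> 1 \<Longrightarrow> finite (B j)" and "\<And>j. j \<ge> 1 \<Longrightarrow> finite (L j)"
    and "\<And>j. j \<ge> 1 \<Longrightarrow> 0 \<in> B j \<inter> L j"
    and "\<And>j. j \<ge> 1 \<Longrightarrow> distinct_cosets (R j) (B j)"
    and "tower_bounds C D"
    and "is_inf_conv R B 0 \<mu>" and "series_converge R B"
    and "no_overlap R B \<mu>"
  shows "(frame_tower R B L C D \<and> delta_Lambda R B L > 0 \<longrightarrow>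
            L2_frame \<mu> (digit_seqs L) (\<lambda>l. expo (freq R l))
              (\<Prod>j. C (Suc j)) (\<Prod>j. D (Suc j)) \<and>
            (inj_on (freq R) (digit_seqs L) \<longrightarrow>
               L2_frame \<mu> (Lambda R L) expo (\<Prod>j. C (Suc j)) (\<Prod>j. D (Suc j)))) \<and>
         (riesz_tower R B L C D \<longrightarrow>
            L2_riesz_sequence \<mu> (Lambda R L) expo (\<Prod>j. C (Suc j)) (\<Prod>j. D (Suc j)))"
proof -
  interpret digit_convolution R B
    by unfold_locales (use assms(2,4,8) expanding_imp_invertible[OF assms(1)] in auto)
  have \<mu>: "\<mu> = distr Om borel X"
    using is_inf_conv_unique[OF assms(7)] is_inf_conv_tail[of 0] by (simp add: tail_0)
  have L: "\<And>k. k \<ge> 1 \<Longrightarrow> finite (L k)" "\<And>k. k \<ge> 1 \<Longrightarrow> 0 \<in> L k"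
    using assms(3,4) by auto
  have im: "freq R ` digit_seqs L = Lambda R L"
    by (rule freq_digit_seqs[OF L(2)])
  show ?thesis
  proof (intro conjI impI)
    assume A: "frame_tower R B L C D \<and> delta_Lambda R B L > 0"
    show fr: "L2_frame \<mu> (digit_seqs L) (\<lambda>l. expo (freq R l)) (\<Prod>j. C (Suc j)) (\<Prod>j. D (Suc j))"
      unfolding \<mu>
    proof (rule frame_exponentials[OF _ L])
      show "delta_Lambda R B L \<le> (cmod (tail_coeff n l))\<^sup>2" if "n \<ge> 1" "l \<in> digs L {1..n}" for n l
        unfolding fourier_mu_gt[symmetric] by (rule delta_Lambda_le[OF L(2) that])
    qed (use A in auto)
    assume inj: "inj_on (freq R) (digit_seqs L)"
    show "L2_frame \<mu> (Lambda R L) expo (\<Prod>j. C (Suc j)) (\<Prod>j. D (Suc j))"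
      using fr unfolding im[symmetric] L2_frame_def summable_on_reindex[OF inj] infsum_reindex[OF inj]
      by (simp add: comp_def)
  next
    assume tower: "riesz_tower R B L C D"
    \<comment> \<open>One expansion is chosen for each frequency. Riesz bounds pass to subfamilies,
      so the chosen expansions suffice; \<open>s\<close> is injective because \<open>freq R\<close>
      undoes it.\<close>
    define s where "s = inv_into (digit_seqs L) (freq R)"
    have s: "s x \<in> digit_seqs L" "freq R (s x) = x" if "x \<in> Lambda R L" for x
      using that inv_into_into[of x "freq R" "digit_seqs L"] f_inv_into_f[of x "freq R" "digit_seqs L"]
      unfolding s_def im by auto
    show "L2_riesz_sequence \<mu> (Lambda R L) expo (\<Prod>j. C (Suc j)) (\<Prod>j. D (Suc j))"
      unfolding L2_riesz_sequence_def
    proof (intro conjI ballI allI impI)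
      show "0 < (\<Prod>j. C (Suc j))" "(\<Prod>j. C (Suc j)) \<le> (\<Prod>j. D (Suc j))"
        using tower_bounds_LIMSEQ[OF assms(6)] by auto
      show "in_L2 \<mu> (expo x)" for x unfolding \<mu> by (rule in_L2_expo)
      fix F and a :: "int^'n \<Rightarrow> complex" assume F: "finite F \<and> F \<subseteq> Lambda R L"
      have inj: "inj_on s F" by (rule inj_on_inverseI[where g="freq R"]) (use F s in auto)
      have F': "finite (s ` F)" "s ` F \<subseteq> digit_seqs L" using F s by auto
      have "a (freq R (s x)) = a x" "expo (freq R (s x)) = expo x" if "x \<in> F" for x
        using F s that by auto
      then have eq: "(\<Sum>l\<in>s ` F. (cmod (a (freq R l)))\<^sup>2) = (\<Sum>x\<in>F. (cmod (a x))\<^sup>2)"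
        "(\<Sum>l\<in>s ` F. a (freq R l) * expo (freq R l) y) = (\<Sum>x\<in>F. a x * expo x y)" for y
        by (simp_all add: sum.reindex[OF inj])
      show "(\<Prod>j. C (Suc j)) * (\<Sum>x\<in>F. (cmod (a x))\<^sup>2) \<le> (\<integral>y. (cmod (\<Sum>x\<in>F. a x * expo x y))\<^sup>2 \<partial>\<mu>)"
        "(\<integral>y. (cmod (\<Sum>x\<in>F. a x * expo x y))\<^sup>2 \<partial>\<mu>) \<le> (\<Prod>j. D (Suc j)) * (\<Sum>x\<in>F. (cmod (a x))\<^sup>2)"
        using riesz_exponentials[OF tower L F', of "\<lambda>l. a (freq R l)"] unfolding \<mu> eq by auto
    qed
  qed
qed

end
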